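(* Let $n\ge1$ and $\phi\in\mathcal{B}_n$. Consider the following nine conditions: - (a1) $t_1^\phi=t_1$; (a2) $t_1^\phi\in(t_1{\star})\setminus\{t_1\}$; (a3) $t_1^\phi\notin(t_1{\star})$; - (b1) $\phi$ is $\sigma_1$-neutral; (b2) $\phi$ is $\sigma_1$-negative; (b3) $\phi$ is $\sigma_1$-positive; - (c1) $(t_1{\star})^\phi=(t_1{\star})$; (c2) $(t_1{\star})^\phi\subsetneq(t_1{\star})$; (c3) $(t_1{\star})^\phi\supsetneq(t_1{\star})$. Then (a1)$\Leftrightarrow$(b1)$\Leftrightarrow$(c1), (a2)$\Leftrightarrow$(b2)$\Leftrightarrow$(c2), and (a3)$\Leftrightarrow$(b3)$\Leftrightarrow$(c3). Moreover, exactly one of (b1), (b2), (b3) holds.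
   Context: $\Sigma_{0,1,n}$ is the free group with free basis $t_1,\dots,t_n$, and $z_1:=(t_1\cdots t_n)^{-1}$. Notation: $\overline a:=a^{-1}$, $a^b:=b^{-1}ab$. Automorphisms act on the right and are written as exponents; they compose left to right. $\mathcal{B}_n$ is the group of all automorphisms $\phi$ of $\Sigma_{0,1,n}$ such that $z_1^\phi=z_1$ and $\phi$ permutes the set of conjugacy classes $\{[t_1],\dots,[t_n]\}$. For $i\in\{1,\dots,n-1\}$, $\sigma_i$ is given by $t_k^{\sigma_i}=t_k$ for $k\notin\{i,i+1\}$, $t_i^{\sigma_i}=t_{i+1}$, and $t_{i+1}^{\sigma_i}=\overline t_{i+1}t_it_{i+1}$. $(w{\star})$ denotes the set of elements whose reduced word in $t_1^{\pm1},\dots,t_n^{\pm1}$ begins with the reduced word of $w$, and $(t_1{\star})^\phi=\{x^\phi: x\in(t_1{\star})\}$. The following notions are used: - $\phi$ is $\sigma_1$-neutral if $\phi$ lies in the subgroup generated by $\sigma_2,\dots,\sigma_{n-1}$. - $\phi$ is $\sigma_1$-positive if $n\ge2$ and $\phi$ is a product of a finite sequence of elements of $\{\sigma_1,\dots,\sigma_{n-1}\}\cup\{\sigma_2^{-1},\dots,\sigma_{n-1}^{-1}\}$ in which $\sigma_1$ occurs at least once. - $\phi$ is $\sigma_1$-negative if $\phi^{-1}$ is $\sigma_1$-positive. *)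

theory Defs
  imports "HOL-Library.Sublist" "HOL-Library.FuncSet"
begin

text \<open>A letter (i, False) stands for t_i, a letter (i, True) for t_i^{-1}.
  Generators are indexed 1..n as in the paper.\<close>

type_synonym letter = "nat \<times> bool"
type_synonym word = "letter list"

definition flip :: "letter \<Rightarrow> letter" where
  "flip a = (fst a, \<not> snd a)"

fun reduced :: "word \<Rightarrow> bool" where
  "reduced [] = True"
| "reduced [a] = True"
| "reduced (a # b # w) = (b \<noteq> flip a \<and> reduced (b # w))"

definition red_cons :: "letter \<Rightarrow> word \<Rightarrow> word" where
  "red_cons a w = (case w of [] \<Rightarrow> [a] | b # w' \<Rightarrow> (if b = flip a then w' else a # w))"

definition reduce :: "word \<Rightarrow> word" where
  "reduce ws = foldr red_cons ws []"

definition F :: "nat \<Rightarrow> word set" where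
  "F n = {w. reduced w \<and> (\<forall>a\<in>set w. 1 \<le> fst a \<and> fst a \<le> n)}"

definition fmul :: "word \<Rightarrow> word \<Rightarrow> word" where
  "fmul u v = reduce (u @ v)"

definition finv :: "word \<Rightarrow> word" where
  "finv w = rev (map flip w)"

definition gen :: "nat \<Rightarrow> word" where
  "gen i = [(i, False)]"

definition z1 :: "nat \<Rightarrow> word" where
  "z1 n = finv (map (\<lambda>i. (i, False)) [1..<Suc n])"

definition conjugate :: "nat \<Rightarrow> word \<Rightarrow> word \<Rightarrow> bool" where
  "conjugate n u v = (\<exists>g\<in>F n. v = fmul (finv g) (fmul u g))"

definition conj_class :: "nat \<Rightarrow> word \<Rightarrow> word set" where
  "conj_class n u = {v \<in> F n. conjugate n u v}"

section \<open>Automorphisms (acting on the right, composed left to right)\<close>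

definition is_aut :: "nat \<Rightarrow> (word \<Rightarrow> word) \<Rightarrow> bool" where
  "is_aut n \<phi> = (\<phi> \<in> extensional (F n) \<and> bij_betw \<phi> (F n) (F n) \<and>
     (\<forall>u\<in>F n. \<forall>v\<in>F n. \<phi> (fmul u v) = fmul (\<phi> u) (\<phi> v)))"

definition comp_aut :: "nat \<Rightarrow> (word \<Rightarrow> word) \<Rightarrow> (word \<Rightarrow> word) \<Rightarrow> (word \<Rightarrow> word)" where
  "comp_aut n \<phi> \<psi> = (\<lambda>x\<in>F n. \<psi> (\<phi> x))"

definition id_aut :: "nat \<Rightarrow> word \<Rightarrow> word" where
  "id_aut n = (\<lambda>x\<in>F n. x)"

definition inv_aut :: "nat \<Rightarrow> (word \<Rightarrow> word) \<Rightarrow> (word \<Rightarrow> word)" where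
  "inv_aut n \<phi> = (\<lambda>x\<in>F n. inv_into (F n) \<phi> x)"

definition ext_hom :: "nat \<Rightarrow> (nat \<Rightarrow> word) \<Rightarrow> (word \<Rightarrow> word)" where
  "ext_hom n f = (\<lambda>w\<in>F n. reduce (concat (map (\<lambda>a. if snd a then finv (f (fst a)) else f (fst a)) w)))"

definition B :: "nat \<Rightarrow> (word \<Rightarrow> word) set" where
  "B n = {\<phi>. is_aut n \<phi> \<and> \<phi> (z1 n) = z1 n \<and>
     bij_betw (\<lambda>C. \<phi> ` C) ((\<lambda>i. conj_class n (gen i)) ` {1..n})
                           ((\<lambda>i. conj_class n (gen i)) ` {1..n})}"

definition sigma :: "nat \<Rightarrow> nat \<Rightarrow> (word \<Rightarrow> word)" where
  "sigma n i = ext_hom n (\<lambda>k. if k = i then gen (Suc i)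
       else if k = Suc i then fmul (finv (gen (Suc i))) (fmul (gen i) (gen (Suc i)))
       else gen k)"

fun aut_prod :: "nat \<Rightarrow> (nat \<times> bool) list \<Rightarrow> (word \<Rightarrow> word)" where
  "aut_prod n [] = id_aut n"
| "aut_prod n (a # as) =
     comp_aut n (if snd a then inv_aut n (sigma n (fst a)) else sigma n (fst a)) (aut_prod n as)"

definition sigma1_neutral :: "nat \<Rightarrow> (word \<Rightarrow> word) \<Rightarrow> bool" where
  "sigma1_neutral n \<phi> =
     (\<exists>ws. (\<forall>a\<in>set ws. 2 \<le> fst a \<and> fst a \<le> n - 1) \<and> \<phi> = aut_prod n ws)"

definition sigma1_positive :: "nat \<Rightarrow> (word \<Rightarrow> word) \<Rightarrow> bool" where
  "sigma1_positive n \<phi> = (2 \<le> n \<and>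
     (\<exists>ws. (\<forall>a\<in>set ws. 1 \<le> fst a \<and> fst a \<le> n - 1 \<and> (snd a \<longrightarrow> 2 \<le> fst a))
          \<and> (1, False) \<in> set ws \<and> \<phi> = aut_prod n ws))"

definition sigma1_negative :: "nat \<Rightarrow> (word \<Rightarrow> word) \<Rightarrow> bool" where
  "sigma1_negative n \<phi> = sigma1_positive n (inv_aut n \<phi>)"

definition star :: "nat \<Rightarrow> word \<Rightarrow> word set" where
  "star n w = {x \<in> F n. prefix w x}"

end

theory Submission
  imports Defs
begin

text \<open>Put \<open>g\<^sub>i = t\<^sub>i\<^sup>\<phi>\<close>. Each \<open>g\<^sub>i\<close> has reduced form \<open>P\<^sub>i c\<^sub>i P\<^sub>i\<^sup>-\<^sup>1\<close> with a generator \<open>c\<^sub>i\<close>, and \<open>g\<^sub>1 \<cdots> g\<^sub>n = t\<^sub>1 \<cdots> t\<^sub>n\<close>.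
  If \<open>P\<^sub>i\<^sub>+\<^sub>1\<close> starts with \<open>P\<^sub>i c\<^sub>i\<^sup>-\<^sup>1\<close>, then \<open>\<phi> = \<sigma>\<^sub>i \<phi>'\<close> with \<open>\<phi>'\<close> shorter; if \<open>P\<^sub>i\<close> starts with
  \<open>P\<^sub>i\<^sub>+\<^sub>1 c\<^sub>i\<^sub>+\<^sub>1\<close>, then \<open>\<phi> = \<sigma>\<^sub>i\<^sup>-\<^sup>1 \<phi>'\<close> with \<open>\<phi>'\<close> shorter (Artin). When \<open>g\<^sub>1\<close> starts with \<open>t\<^sub>1\<close>, counting
  the letters \<open>t\<^sub>1\<^sup>\<plusminus>\<^sup>1\<close> shows that some step other than \<open>\<sigma>\<^sub>1\<close> is possible unless \<open>\<phi>\<close> is trivial; hence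
  \<open>\<phi>\<close> is neutral or negative. When \<open>g\<^sub>1\<close> does not start with \<open>t\<^sub>1\<close>, conjugation by the mirror
  involution \<open>t\<^sub>1 \<cdots> t\<^sub>k \<mapsto> (t\<^sub>1 \<cdots> t\<^sub>k)\<^sup>-\<^sup>1\<close>, which inverts every \<open>\<sigma>\<^sub>i\<close>, reduces to the first case.
  Conversely \<open>\<sigma>\<^sub>1\<^sup>-\<^sup>1\<close> maps \<open>(t\<^sub>1\<star>)\<close> into \<open>(t\<^sub>1t\<^sub>2\<star>)\<close> and \<open>\<sigma>\<^sub>i\<^sup>\<plusminus>\<^sup>1\<close>, \<open>i \<ge> 2\<close>, fix \<open>(t\<^sub>1\<star>)\<close>, so the
  conditions on \<open>t\<^sub>1\<^sup>\<phi>\<close> and \<open>(t\<^sub>1\<star>)\<^sup>\<phi>\<close> can be read off from a braid word.\<close>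

section \<open>Reduced words and free reduction\<close>

lemma flip_flip [simp]: "flip (flip a) = a"
  by (simp add: flip_def)

lemma fst_flip [simp]: "fst (flip a) = fst a"
  by (simp add: flip_def)

lemma flip_Pair [simp]: "flip (i, b) = (i, \<not> b)"
  by (simp add: flip_def)

lemma flip_neq [simp]: "flip a \<noteq> a" "a \<noteq> flip a"
  by (cases a; simp)+

lemma flip_eq_iff [simp]: "flip a = flip b \<longleftrightarrow> a = b"
  by (metis flip_flip)

lemma fst_eq_imp_eq_or_flip: "fst a = fst b \<Longrightarrow> a = b \<or> a = flip b"
  by (cases a; cases b) auto

lemma finv_Nil [simp]: "finv [] = []"
  by (simp add: finv_def)

lemma finv_Cons [simp]: "finv (a # w) = finv w @ [flip a]"
  by (simp add: finv_def)

lemma finv_append [simp]: "finv (u @ v) = finv v @ finv u"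
  by (simp add: finv_def)

lemma finv_finv [simp]: "finv (finv w) = w"
  by (induction w) auto

lemma finv_eq_Nil [simp]: "finv w = [] \<longleftrightarrow> w = []"
  by (simp add: finv_def)

lemma in_set_finv [simp]: "a \<in> set (finv w) \<longleftrightarrow> flip a \<in> set w"
  by (force simp: finv_def image_iff)

lemma hd_finv: "w \<noteq> [] \<Longrightarrow> hd (finv w) = flip (last w)"
  by (simp add: finv_def hd_rev last_map)

lemma last_finv: "w \<noteq> [] \<Longrightarrow> last (finv w) = flip (hd w)"
  by (simp add: finv_def last_rev hd_map)

lemma reduced_iff_successively: "reduced w \<longleftrightarrow> successively (\<lambda>a b. b \<noteq> flip a) w"
  by (induction w rule: reduced.induct) auto

lemma reduced_append:
  "reduced (u @ v) \<longleftrightarrow> reduced u \<and> reduced v \<and> (u \<noteq> [] \<longrightarrow> v \<noteq> [] \<longrightarrow> hd v \<noteq> flip (last u))"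
  by (auto simp: reduced_iff_successively successively_append_iff)

lemma reduced_appendD: "reduced (u @ v) \<Longrightarrow> reduced u" "reduced (u @ v) \<Longrightarrow> reduced v"
  by (simp_all add: reduced_append)

lemma reduced_Cons: "reduced (a # w) \<longleftrightarrow> reduced w \<and> (w \<noteq> [] \<longrightarrow> hd w \<noteq> flip a)"
  using reduced_append[of "[a]" w] by auto

lemma reduced_map_flip [simp]: "reduced (map flip w) \<longleftrightarrow> reduced w"
  by (simp only: reduced_iff_successively successively_map flip_eq_iff)

lemma reduced_rev [simp]: "reduced (rev w) \<longleftrightarrow> reduced w"
proof -
  have "(\<lambda>a b. a \<noteq> flip b) = (\<lambda>a b. b \<noteq> flip a)"
    by (auto simp: fun_eq_iff)
  then show ?thesis
    unfolding reduced_iff_successively successively_rev by (rule arg_cong)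
qed

lemma reduced_finv [simp]: "reduced (finv w) \<longleftrightarrow> reduced w"
  by (simp add: finv_def)

lemma reduced_map_positive: "reduced (map (\<lambda>i. (f i, False)) l)"
  by (simp add: reduced_iff_successively successively_map successively_conv_nth)

lemma red_cons_Nil [simp]: "red_cons a [] = [a]"
  by (simp add: red_cons_def)

lemma red_cons_Cons: "red_cons a (b # w) = (if b = flip a then w else a # b # w)"
  by (simp add: red_cons_def)

lemma red_cons_reduced: "reduced (a # w) \<Longrightarrow> red_cons a w = a # w"
  by (cases w) (auto simp: red_cons_Cons)

lemma reduced_red_cons: "reduced w \<Longrightarrow> reduced (red_cons a w)"
  by (cases w) (auto simp: red_cons_Cons reduced_Cons)

lemma red_cons_flip: "reduced w \<Longrightarrow> red_cons a (red_cons (flip a) w) = w"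
  by (cases w rule: reduced.cases) (auto simp: red_cons_Cons)

lemma reduce_Nil [simp]: "reduce [] = []"
  by (simp add: reduce_def)

lemma reduce_Cons: "reduce (a # w) = red_cons a (reduce w)"
  by (simp add: reduce_def)

lemma reduced_reduce [simp]: "reduced (reduce w)"
  by (induction w) (auto simp: reduce_Cons reduced_red_cons)

lemma reduce_reduced [simp]: "reduced w \<Longrightarrow> reduce w = w"
  by (induction w) (auto simp: reduce_Cons reduced_Cons red_cons_reduced)

lemma subseq_reduce: "subseq (reduce w) w"
proof (induction w)
  case (Cons a w)
  have "subseq (red_cons a (reduce w)) (a # reduce w)"
    by (cases "reduce w") (auto simp: red_cons_Cons)
  with Cons.IH show ?case
    unfolding reduce_Cons by (meson subseq_Cons2 subseq_order.order_trans)
qed simp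

lemma set_reduce: "set (reduce w) \<subseteq> set w"
  using list_emb_set[OF subseq_reduce] by blast

lemma length_reduce: "length (reduce w) \<le> length w"
  by (rule list_emb_length[OF subseq_reduce])

abbreviation free_eq :: "word \<Rightarrow> word \<Rightarrow> bool" (infix "\<approx>" 50) where
  "u \<approx> v \<equiv> reduce u = reduce v"

lemma free_eq_reduce: "reduce u = v \<Longrightarrow> u \<approx> v"
  by auto

lemma reduce_append_reduce_right [simp]: "u @ reduce v \<approx> u @ v"
  by (induction u) (auto simp: reduce_Cons)

lemma reduce_append_reduce_left [simp]: "reduce u @ v \<approx> u @ v"
proof (induction u)
  case (Cons a u)
  have "red_cons a w @ v \<approx> a # w @ v" for w
    by (cases w) (auto simp: red_cons_Cons reduce_Cons red_cons_flip)
  with Cons.IH show ?case by (simp add: reduce_Cons)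
qed simp

lemma append_free_cong: "u \<approx> u' \<Longrightarrow> v \<approx> v' \<Longrightarrow> u @ v \<approx> u' @ v'"
  by (metis reduce_append_reduce_left reduce_append_reduce_right)

lemma append_finv_cancel [simp]: "u @ finv u @ w \<approx> w"
proof (induction u arbitrary: w)
  case (Cons a u)
  have "reduce ((a # u) @ finv (a # u) @ w) = red_cons a (reduce (u @ finv u @ flip a # w))"
    by (simp add: reduce_Cons)
  also have "\<dots> = red_cons a (reduce (flip a # w))"
    by (simp only: Cons.IH)
  also have "\<dots> = reduce w"
    by (simp add: reduce_Cons red_cons_flip)
  finally show ?case .
qed simp

lemma finv_append_cancel [simp]: "finv u @ u @ w \<approx> w"
  using append_finv_cancel[of "finv u" w] by simp

lemma reduce_finv: "reduce (finv w) = finv (reduce w)"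
proof -
  have "reduce w @ finv w \<approx> []"
    using append_finv_cancel[of w "[]"] by simp
  then have "finv (reduce w) @ reduce w @ finv w \<approx> finv (reduce w) @ []"
    by (rule append_free_cong[OF refl])
  then show ?thesis by (simp only: finv_append_cancel) simp
qed

lemma finv_free_cong: "u \<approx> v \<Longrightarrow> finv u \<approx> finv v"
  by (simp add: reduce_finv)

lemma append_free_eq_left_cancel: "u @ v \<approx> u @ v' \<longleftrightarrow> v \<approx> v'"
  by (metis append_free_cong finv_append_cancel)

text \<open>Rewriting a word to a right-nested product makes cancelling factors adjacent.\<close>

lemma free_group_simps:
  "reduce (u @ v) = fmul u (reduce v)"
  "reduce (a # w) = red_cons a (reduce w)"
  "reduce (fmul u v) = fmul u v"
  "reduced (fmul u v)"
  "reduced w \<Longrightarrow> reduced (red_cons a w)"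
  "fmul [] w = reduce w"
  "fmul u [] = reduce u"
  "fmul (u @ v) w = fmul u (fmul v w)"
  "fmul (a # u) w = red_cons a (fmul u w)"
  "fmul (reduce u) v = fmul u v"
  "fmul u (finv u) = []"
  "fmul (finv u) u = []"
  "fmul u (reduce (finv u)) = []"
  "fmul (finv u) (reduce u) = []"
  "fmul u (fmul (finv u) w) = reduce w"
  "fmul (finv u) (fmul u w) = reduce w"
  "red_cons a [flip a] = []"
  "red_cons (flip a) [a] = []"
  "red_cons (i, False) [(i, True)] = []"
  "red_cons (i, True) [(i, False)] = []"
  "reduced w \<Longrightarrow> red_cons a (red_cons (flip a) w) = w"
  "reduced w \<Longrightarrow> red_cons (flip a) (red_cons a w) = w"
  "reduced w \<Longrightarrow> red_cons (i, False) (red_cons (i, True) w) = w"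
  "reduced w \<Longrightarrow> red_cons (i, True) (red_cons (i, False) w) = w"
  using append_finv_cancel[of u "[]"] finv_append_cancel[of u "[]"]
    red_cons_flip[of w a] red_cons_flip[of w "flip a"]
    red_cons_flip[of w "(i, False)"] red_cons_flip[of w "(i, True)"]
  by (simp_all add: fmul_def reduce_Cons reduced_red_cons red_cons_Cons)

definition words :: "nat \<Rightarrow> word set" where
  "words n = {w. \<forall>a\<in>set w. fst a \<in> {1..n}}"

lemma words_simps [simp]:
  "[] \<in> words n"
  "a # w \<in> words n \<longleftrightarrow> fst a \<in> {1..n} \<and> w \<in> words n"
  "u @ v \<in> words n \<longleftrightarrow> u \<in> words n \<and> v \<in> words n"
  "finv w \<in> words n \<longleftrightarrow> w \<in> words n"
  "map flip w \<in> words n \<longleftrightarrow> w \<in> words n"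
  by (auto simp: words_def finv_def)

lemma F_iff: "w \<in> F n \<longleftrightarrow> reduced w \<and> w \<in> words n"
  by (auto simp: F_def words_def)

lemma reduce_words [simp]: "w \<in> words n \<Longrightarrow> reduce w \<in> words n"
  using set_reduce[of w] by (auto simp: words_def)

lemma gen_words [simp]: "gen i \<in> words n \<longleftrightarrow> i \<in> {1..n}"
  by (simp add: gen_def)

lemma reduced_gen [simp]: "reduced (gen i)"
  by (simp add: gen_def)

lemma prefix_gen_iff: "prefix (gen i) w \<longleftrightarrow> w \<noteq> [] \<and> hd w = (i, False)"
  by (cases w) (auto simp: gen_def)

section \<open>Substitutions and endomorphisms\<close>

definition signed :: "bool \<Rightarrow> word \<Rightarrow> word" where
  "signed e w = (if e then finv w else w)"

lemma signed_simps [simp]: "signed False w = w" "signed True w = finv w"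
  by (simp_all add: signed_def)

lemma signed_signed [simp]: "signed d (signed e w) = signed (d \<noteq> e) w"
  by (simp add: signed_def)

lemma reduce_signed: "reduce (signed e w) = signed e (reduce w)"
  by (simp add: signed_def reduce_finv)

lemma signed_words [simp]: "signed e w \<in> words n \<longleftrightarrow> w \<in> words n"
  by (simp add: signed_def)

definition subst :: "(nat \<Rightarrow> word) \<Rightarrow> word \<Rightarrow> word" where
  "subst f w = concat (map (\<lambda>a. signed (snd a) (f (fst a))) w)"

lemma subst_simps [simp]:
  "subst f [] = []"
  "subst f (a # w) = signed (snd a) (f (fst a)) @ subst f w"
  "subst f (u @ v) = subst f u @ subst f v"
  by (simp_all add: subst_def)

lemma subst_gen [simp]: "subst f (gen i) = f i"
  by (simp add: gen_def)

lemma subst_finv [simp]: "subst f (finv w) = finv (subst f w)"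
  by (induction w) (auto simp: flip_def signed_def)

lemma subst_signed [simp]: "subst f (signed e w) = signed e (subst f w)"
  by (simp add: signed_def)

lemma subst_subst: "subst g (subst f w) = subst (\<lambda>i. subst g (f i)) w"
  by (induction w) auto

lemma subst_gen_id [simp]: "subst gen w = w"
  by (induction w) (auto simp: gen_def signed_def prod_eq_iff flip_def)

lemma subst_finv_img: "subst (\<lambda>i. finv (f i)) w = subst f (map flip w)"
  by (induction w) (auto simp: signed_def flip_def)

lemma subst_words:
  assumes "\<And>i. i \<in> {1..n} \<Longrightarrow> f i \<in> words n" and "w \<in> words n"
  shows "subst f w \<in> words n"
  using assms(2) by (induction w) (auto simp: assms(1))

lemma subst_free_cong_img:
  assumes "\<And>a. a \<in> set w \<Longrightarrow> f (fst a) \<approx> g (fst a)"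
  shows "subst f w \<approx> subst g w"
  using assms
proof (induction w)
  case (Cons a w)
  then have "signed (snd a) (f (fst a)) \<approx> signed (snd a) (g (fst a))"
    by (simp add: reduce_signed)
  with Cons show ?case by (auto intro: append_free_cong)
qed simp

lemma subst_reduce [simp]: "subst f (reduce w) \<approx> subst f w"
proof (induction w)
  case (Cons a w)
  have "subst f (red_cons a v) \<approx> subst f (a # v)" for v
    by (cases v; cases a) (auto simp: red_cons_Cons signed_def free_group_simps)
  then have "subst f (reduce (a # w)) \<approx> subst f [a] @ subst f (reduce w)"
    by (simp add: reduce_Cons)
  also have "\<dots> = reduce (subst f [a] @ subst f w)"
    by (rule append_free_cong[OF refl Cons.IH])
  finally show ?case by simp
qed simp

lemma subst_free_cong: "u \<approx> v \<Longrightarrow> subst f u \<approx> subst f v"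
  by (metis subst_reduce)

lemma ext_hom_apply: "w \<in> F n \<Longrightarrow> ext_hom n f w = reduce (subst f w)"
  by (simp add: ext_hom_def subst_def signed_def)

lemma ext_hom_extensional [simp]: "ext_hom n f \<in> extensional (F n)"
  by (simp add: ext_hom_def)

lemma ext_hom_cong:
  assumes "\<And>i. i \<in> {1..n} \<Longrightarrow> f i \<approx> g i"
  shows "ext_hom n f = ext_hom n g"
proof (rule extensionalityI[where A = "F n"])
  fix w assume "w \<in> F n"
  then have "subst f w \<approx> subst g w"
    by (intro subst_free_cong_img assms) (auto simp: F_def)
  with \<open>w \<in> F n\<close> show "ext_hom n f w = ext_hom n g w"
    by (simp add: ext_hom_apply)
qed simp_all

lemma ext_hom_in_F:
  assumes "\<And>i. i \<in> {1..n} \<Longrightarrow> f i \<in> words n" and "w \<in> F n"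
  shows "ext_hom n f w \<in> F n"
  using subst_words[of n f w, OF assms(1)] assms(2) by (simp add: ext_hom_apply F_iff)

lemma comp_ext_hom:
  assumes "\<And>i. i \<in> {1..n} \<Longrightarrow> f i \<in> words n"
  shows "comp_aut n (ext_hom n f) (ext_hom n g) = ext_hom n (\<lambda>i. subst g (f i))"
proof (rule extensionalityI[where A = "F n"])
  fix w assume w: "w \<in> F n"
  then show "comp_aut n (ext_hom n f) (ext_hom n g) w = ext_hom n (\<lambda>i. subst g (f i)) w"
    using ext_hom_in_F[OF assms w]
    by (simp add: comp_aut_def ext_hom_apply subst_words[OF assms] F_iff subst_subst)
qed (simp_all add: comp_aut_def)

lemma id_aut_ext_hom: "id_aut n = ext_hom n gen"
  by (rule extensionalityI[where A = "F n"]) (simp_all add: id_aut_def ext_hom_apply F_iff)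

lemma inv_aut_eqI:
  assumes "\<And>w. w \<in> F n \<Longrightarrow> f w \<in> F n \<and> g w \<in> F n \<and> g (f w) = w \<and> f (g w) = w"
    and "g \<in> extensional (F n)"
  shows "inv_aut n f = g"
proof (rule extensionalityI[where A = "F n"])
  have "inj_on f (F n)"
    using assms(1) by (metis inj_onI)
  then show "inv_aut n f w = g w" if "w \<in> F n" for w
    using assms(1)[OF that] that by (auto simp: inv_aut_def intro: inv_into_f_eq)
qed (simp_all add: inv_aut_def assms(2))

lemma inv_aut_inv_aut:
  assumes "is_aut n f"
  shows "inv_aut n (inv_aut n f) = f"
  using assms unfolding is_aut_def
  by (intro inv_aut_eqI)
    (auto simp: inv_aut_def bij_betwE bij_betw_inv_into_left bij_betw_inv_into_right
      bij_betw_apply[OF bij_betw_inv_into])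

lemma subst_left_inverse:
  assumes "\<And>i. subst g (f i) \<approx> gen i"
  shows "subst g (subst f w) \<approx> w"
proof -
  have "subst (\<lambda>i. subst g (f i)) w \<approx> subst gen w"
    by (rule subst_free_cong_img) (rule assms)
  then show ?thesis by (simp add: subst_subst)
qed

lemma inv_aut_ext_hom:
  assumes "\<And>i. i \<in> {1..n} \<Longrightarrow> f i \<in> words n" "\<And>i. i \<in> {1..n} \<Longrightarrow> g i \<in> words n"
    and "\<And>w. subst g (subst f w) \<approx> w" "\<And>w. subst f (subst g w) \<approx> w"
  shows "inv_aut n (ext_hom n f) = ext_hom n g"
proof (rule inv_aut_eqI)
  fix w assume w: "w \<in> F n"
  from ext_hom_in_F[OF assms(1) w] ext_hom_in_F[OF assms(2) w] assms(3,4)[of w] w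
  show "ext_hom n f w \<in> F n \<and> ext_hom n g w \<in> F n
    \<and> ext_hom n g (ext_hom n f w) = w \<and> ext_hom n f (ext_hom n g w) = w"
    by (simp add: ext_hom_apply F_iff)
qed simp

section \<open>Braid words\<close>

text \<open>For \<open>p = t\<^sub>i\<close>, \<open>q = t\<^sub>i\<^sub>+\<^sub>1\<close> the substitution \<open>p \<mapsto> p q p\<^sup>-\<^sup>1\<close>, \<open>q \<mapsto> p\<close> is \<open>\<sigma>\<^sub>i\<^sup>-\<^sup>1\<close>; for the inverse
  letters \<open>p = t\<^sub>i\<^sub>+\<^sub>1\<^sup>-\<^sup>1\<close>, \<open>q = t\<^sub>i\<^sup>-\<^sup>1\<close> it is \<open>\<sigma>\<^sub>i\<close>.\<close>

definition half_twist :: "letter \<Rightarrow> letter \<Rightarrow> nat \<Rightarrow> word" where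
  "half_twist p q k =
     (if k = fst p then signed (snd p) [p, q, flip p]
      else if k = fst q then signed (snd q) [p] else gen k)"

lemma subst_half_twist:
  assumes "fst p \<noteq> fst q"
  shows "subst (half_twist p q) [p] = [p, q, flip p]"
    and "subst (half_twist p q) [flip p] = [p, flip q, flip p]"
    and "subst (half_twist p q) [q] = [p]"
    and "subst (half_twist p q) [flip q] = [flip p]"
    and "fst a \<notin> {fst p, fst q} \<Longrightarrow> subst (half_twist p q) [a] = [a]"
  using assms by (cases p; cases q; cases a; auto simp: half_twist_def gen_def signed_def)+

lemma half_twist_inverse:
  assumes "fst p \<noteq> fst q"
  shows "subst (half_twist (flip q) (flip p)) (half_twist p q k) \<approx> gen k"
  using assms
  by (cases p; cases q; cases "snd p"; cases "snd q")
    (auto simp: half_twist_def gen_def signed_def free_group_simps)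

definition sigma_img :: "nat \<times> bool \<Rightarrow> nat \<Rightarrow> word" where
  "sigma_img a = (if snd a then half_twist (fst a, False) (Suc (fst a), False)
                  else half_twist (Suc (fst a), True) (fst a, True))"

lemma sigma_img_simps [simp]:
  "sigma_img (i, True) i = [(i, False), (Suc i, False), (i, True)]"
  "sigma_img (i, True) (Suc i) = gen i"
  "sigma_img (i, False) i = gen (Suc i)"
  "sigma_img (i, False) (Suc i) = [(Suc i, True), (i, False), (Suc i, False)]"
  by (simp_all add: sigma_img_def half_twist_def gen_def)

lemma sigma_img_other [simp]: "k \<noteq> fst a \<Longrightarrow> k \<noteq> Suc (fst a) \<Longrightarrow> sigma_img a k = gen k"
  by (simp add: sigma_img_def half_twist_def)

lemma sigma_img_words:
  assumes "fst a \<in> {1..n - 1}" "k \<in> {1..n}"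
  shows "sigma_img a k \<in> words n"
  using assms
  by (cases a; cases "snd a"; cases "k = fst a"; cases "k = Suc (fst a)") auto

lemma subst_sigma_img_flip: "subst (sigma_img (flip a)) (subst (sigma_img a) w) \<approx> w"
proof (rule subst_left_inverse)
  show "subst (sigma_img (flip a)) (sigma_img a k) \<approx> gen k" for k
    using half_twist_inverse[of "(fst a, False)" "(Suc (fst a), False)" k]
      half_twist_inverse[of "(Suc (fst a), True)" "(fst a, True)" k]
    by (cases a) (auto simp: sigma_img_def)
qed

lemma sigma_ext_hom: "sigma n i = ext_hom n (sigma_img (i, False))"
  unfolding sigma_def
proof (rule ext_hom_cong)
  fix k
  consider "k = i" | "k = Suc i" | "k \<noteq> i" "k \<noteq> Suc i" by blast
  then show "(if k = i then gen (Suc i)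
      else if k = Suc i then fmul (finv (gen (Suc i))) (fmul (gen i) (gen (Suc i))) else gen k)
      \<approx> sigma_img (i, False) k"
    by cases (simp_all add: free_group_simps gen_def)
qed

lemma inv_aut_sigma:
  assumes "i \<in> {1..n - 1}"
  shows "inv_aut n (sigma n i) = ext_hom n (sigma_img (i, True))"
  unfolding sigma_ext_hom
  using subst_sigma_img_flip[of "(i, False)"] subst_sigma_img_flip[of "(i, True)"] assms
  by (intro inv_aut_ext_hom sigma_img_words) auto

fun braid_img :: "(nat \<times> bool) list \<Rightarrow> nat \<Rightarrow> word" where
  "braid_img [] = gen"
| "braid_img (a # ws) = (\<lambda>k. subst (braid_img ws) (sigma_img a k))"

lemma subst_braid_img_Cons:
  "subst (braid_img (a # ws)) w = subst (braid_img ws) (subst (sigma_img a) w)"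
  by (simp add: subst_subst)

lemma subst_braid_img_append:
  "subst (braid_img (us @ ws)) w = subst (braid_img ws) (subst (braid_img us) w)"
  by (induction us arbitrary: w) (simp_all add: subst_braid_img_Cons del: braid_img.simps(2))

lemma subst_braid_img_finv: "subst (braid_img (finv ws)) (subst (braid_img ws) w) \<approx> w"
proof (induction ws arbitrary: w)
  case (Cons a ws)
  have "subst (braid_img (finv (a # ws))) (subst (braid_img (a # ws)) w)
      = subst (sigma_img (flip a))
          (subst (braid_img (finv ws)) (subst (braid_img ws) (subst (sigma_img a) w)))"
    by (simp add: subst_braid_img_append subst_subst)
  also have "\<dots> \<approx> subst (sigma_img (flip a)) (subst (sigma_img a) w)"
    by (rule subst_free_cong) (rule Cons.IH)
  also have "\<dots> = reduce w"
    by (rule subst_sigma_img_flip)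
  finally show ?case .
qed simp

lemma braid_img_words:
  assumes "ws \<in> words (n - 1)" "k \<in> {1..n}"
  shows "braid_img ws k \<in> words n"
  using assms
proof (induction ws arbitrary: k)
  case (Cons a ws)
  then have "sigma_img a k \<in> words n"
    by (intro sigma_img_words) auto
  with Cons show ?case by (auto intro: subst_words)
qed simp

lemma aut_prod_ext_hom:
  assumes "ws \<in> words (n - 1)"
  shows "aut_prod n ws = ext_hom n (braid_img ws)"
  using assms
proof (induction ws)
  case Nil
  then show ?case by (simp add: id_aut_ext_hom)
next
  case (Cons a ws)
  then have a: "fst a \<in> {1..n - 1}" by simp
  then have "(if snd a then inv_aut n (sigma n (fst a)) else sigma n (fst a)) = ext_hom n (sigma_img a)"
    by (cases a; cases "snd a") (simp_all add: inv_aut_sigma, simp add: sigma_ext_hom)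
  with Cons have "aut_prod n (a # ws) = comp_aut n (ext_hom n (sigma_img a)) (ext_hom n (braid_img ws))"
    by simp
  also have "\<dots> = ext_hom n (braid_img (a # ws))"
    using a by (simp only: braid_img.simps) (intro comp_ext_hom sigma_img_words)
  finally show ?case .
qed

lemma inv_aut_prod:
  assumes "ws \<in> words (n - 1)"
  shows "inv_aut n (aut_prod n ws) = aut_prod n (finv ws)"
proof -
  have "inv_aut n (ext_hom n (braid_img ws)) = ext_hom n (braid_img (finv ws))"
    using assms subst_braid_img_finv[of ws] subst_braid_img_finv[of "finv ws"]
    by (intro inv_aut_ext_hom braid_img_words) auto
  with assms show ?thesis by (simp add: aut_prod_ext_hom)
qed

lemma aut_prod_in_F:
  assumes "ws \<in> words (n - 1)" "w \<in> F n"
  shows "aut_prod n ws w \<in> F n"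
  unfolding aut_prod_ext_hom[OF assms(1)] using assms by (intro ext_hom_in_F braid_img_words)

lemma aut_prod_finv:
  assumes "ws \<in> words (n - 1)" "w \<in> F n"
  shows "aut_prod n (finv ws) (aut_prod n ws w) = w"
  using aut_prod_in_F[OF assms] subst_braid_img_finv[of ws w] assms
  by (simp add: aut_prod_ext_hom ext_hom_apply F_iff)

section \<open>Initial letters of images under braid words\<close>

inductive half_twist_head :: "letter \<Rightarrow> letter \<Rightarrow> word \<Rightarrow> word \<Rightarrow> bool" for p q where
  empty: "half_twist_head p q [] []"
| p: "half_twist_head p q (p # w) (p # q # v)"
| p_inverse: "half_twist_head p q (flip p # w) (p # flip q # v)"
| q_single: "half_twist_head p q (q # w) [p]"
| q: "fst b \<noteq> fst q \<Longrightarrow> half_twist_head p q (q # w) (p # b # v)"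
| q_inverse_p: "half_twist_head p q (flip q # w) (flip p # v)"
| q_inverse_q: "fst b = fst q \<Longrightarrow> half_twist_head p q (flip q # w) (b # v)"
| other: "fst a \<noteq> fst p \<Longrightarrow> fst a \<noteq> fst q \<Longrightarrow> half_twist_head p q (a # w) (a # v)"

lemma half_twist_head_Cons:
  assumes pq: "fst p \<noteq> fst q" and aw: "reduced (a # w)" and head: "half_twist_head p q w u"
  shows "half_twist_head p q (a # w) (foldr red_cons (subst (half_twist p q) [a]) u)"
proof -
  have distinct: "b \<noteq> c" if "fst b \<noteq> fst c" for b c :: letter
    using that by blast
  note head_simps = subst_half_twist[OF pq] red_cons_Cons distinct pq pq[symmetric] half_twist_head.intros
  consider (p) "a = p" | (p_inverse) "a = flip p" | (q) "a = q" | (q_inverse) "a = flip q"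
    | (other) "fst a \<noteq> fst p" "fst a \<noteq> fst q"
    using fst_eq_imp_eq_or_flip by blast
  then show ?thesis
  proof cases
    case p
    from head aw show ?thesis
      unfolding p by cases (simp_all add: head_simps del: subst_simps(2))
  next
    case p_inverse
    from head aw show ?thesis
      unfolding p_inverse by cases (simp_all add: head_simps del: subst_simps(2))
  next
    case q
    from head aw show ?thesis
      unfolding q by cases (simp_all add: head_simps del: subst_simps(2))
  next
    case q_inverse
    from head aw show ?thesis
      unfolding q_inverse by cases (simp_all add: head_simps del: subst_simps(2))
  next
    case other
    from head aw show ?thesis
      by cases (simp_all add: head_simps other other[symmetric] del: subst_simps(2))
  qed
qed

lemma half_twist_head_subst:
  assumes "fst p \<noteq> fst q" "reduced w"
  shows "half_twist_head p q w (reduce (subst (half_twist p q) w))"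
  using assms(2)
proof (induction w)
  case Nil
  then show ?case by (simp add: half_twist_head.empty)
next
  case (Cons a w)
  let ?u = "reduce (subst (half_twist p q) w)"
  from Cons.prems have "reduced w" by (simp add: reduced_Cons)
  then have "half_twist_head p q (a # w) (foldr red_cons (subst (half_twist p q) [a]) ?u)"
    by (intro half_twist_head_Cons assms(1) Cons)
  then show ?case by (simp add: reduce_def)
qed

lemma sigma1_inverse_prefix:
  assumes "reduced w" "prefix (gen 1) w"
  shows "prefix [(1, False), (2, False)] (reduce (subst (sigma_img (1, True)) w))"
proof -
  have "half_twist_head (1, False) (2, False) w (reduce (subst (sigma_img (1, True)) w))"
    using half_twist_head_subst[of "(1, False)" "(2, False)" w] assms(1)
    by (simp add: sigma_img_def numeral_2_eq_2)
  then show ?thesis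
    by cases (use assms(2) in \<open>auto simp: gen_def\<close>)
qed

lemma sigma_img_prefix:
  assumes "2 \<le> fst a" "reduced w" "prefix (gen 1) w"
  shows "prefix (gen 1) (reduce (subst (sigma_img a) w))"
proof -
  obtain p q where "sigma_img a = half_twist p q" "fst p \<noteq> fst q" and pq: "2 \<le> fst p" "2 \<le> fst q"
    using that[of "(fst a, False)" "(Suc (fst a), False)"]
      that[of "(Suc (fst a), True)" "(fst a, True)"]
      assms(1)
    by (cases "snd a") (auto simp: sigma_img_def)
  then have "half_twist_head p q w (reduce (subst (sigma_img a) w))"
    using half_twist_head_subst[of p q w] assms(2) by simp
  then show ?thesis
  proof cases
    case (other b v u)
    with assms(3) show ?thesis by (simp add: gen_def)
  qed (use assms(3) pq in \<open>auto simp: gen_def flip_def\<close>)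
qed

definition nonpos_words :: "nat \<Rightarrow> (nat \<times> bool) list set" where
  "nonpos_words n = {ws \<in> words (n - 1). (1, False) \<notin> set ws}"

lemma nonpos_words_simps [simp]:
  "[] \<in> nonpos_words n"
  "a # ws \<in> nonpos_words n \<longleftrightarrow> fst a \<in> {1..n - 1} \<and> a \<noteq> (1, False) \<and> ws \<in> nonpos_words n"
  "us @ ws \<in> nonpos_words n \<longleftrightarrow> us \<in> nonpos_words n \<and> ws \<in> nonpos_words n"
  by (auto simp: nonpos_words_def)

lemma nonpos_words_neutral:
  assumes "ws \<in> nonpos_words n" "(1, True) \<notin> set ws"
  shows "\<forall>a\<in>set ws. 2 \<le> fst a"
proof
  fix a assume "a \<in> set ws"
  with assms have "1 \<le> fst a" "a \<noteq> (1, False)" "a \<noteq> (1, True)"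
    by (auto simp: nonpos_words_def words_def)
  then show "2 \<le> fst a" by (cases a; cases "snd a") auto
qed

lemma nonpos_braid_prefix:
  assumes "ws \<in> nonpos_words n" "prefix (gen 1) (reduce w)"
  shows "prefix (gen 1) (reduce (subst (braid_img ws) w))"
  using assms
proof (induction ws arbitrary: w)
  case (Cons a ws)
  consider (sigma1_inverse) "a = (1, True)" | (neutral) "2 \<le> fst a"
    using nonpos_words_neutral[of "[a]" n] Cons.prems(1) by auto
  then have "prefix (gen 1) (reduce (subst (sigma_img a) (reduce w)))"
  proof cases
    case sigma1_inverse
    then show ?thesis
      using sigma1_inverse_prefix[of "reduce w"] Cons.prems(2) by (auto simp: gen_def prefix_def)
  qed (intro sigma_img_prefix Cons.prems reduced_reduce)
  with Cons show ?case by (simp add: subst_braid_img_Cons del: braid_img.simps)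
qed simp

lemma neutral_braid_img_1:
  assumes "\<forall>a\<in>set ws. 2 \<le> fst a"
  shows "braid_img ws 1 = gen 1"
  using assms by (induction ws) auto

lemma negative_braid_not_gen1:
  assumes ws: "ws \<in> nonpos_words n" "(1, True) \<in> set ws" and w: "prefix (gen 1) (reduce w)"
  shows "reduce (subst (braid_img ws) w) \<noteq> gen 1"
proof
  assume fixed: "reduce (subst (braid_img ws) w) = gen 1"
  obtain us vs where split: "ws = us @ (1, True) # vs" "(1, True) \<notin> set vs"
    using split_list_last[OF ws(2)] by blast
  let ?v = "reduce (subst (braid_img us) w)"
  have "prefix (gen 1) ?v"
    using ws(1) w split(1) by (intro nonpos_braid_prefix) auto
  then have start: "prefix [(1, False), (2, False)] (reduce (subst (sigma_img (1, True)) ?v))"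
    by (intro sigma1_inverse_prefix reduced_reduce)
  have "\<forall>a\<in>set vs. 2 \<le> fst a"
    using ws(1) split by (intro nonpos_words_neutral) auto
  then have "braid_img vs 1 = gen 1"
    by (rule neutral_braid_img_1)
  then have "subst (braid_img vs) (subst (sigma_img (1, True)) ?v) \<approx> subst (braid_img vs) (gen 1)"
    using fixed subst_free_cong[OF subst_reduce[of "sigma_img (1, True)" "subst (braid_img us) w"]]
    by (simp add: split(1) subst_braid_img_append subst_braid_img_Cons del: braid_img.simps)
  then have "subst (sigma_img (1, True)) ?v \<approx> gen 1"
    by (metis subst_braid_img_finv subst_free_cong)
  with start show False by (simp add: gen_def)
qed

section \<open>Braid tuples\<close>

definition gen_prod :: "nat \<Rightarrow> word" where
  "gen_prod k = map (\<lambda>i. (i, False)) [1..<Suc k]"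

lemma gen_prod_0 [simp]: "gen_prod 0 = []"
  by (simp add: gen_prod_def)

lemma gen_prod_Suc: "gen_prod (Suc k) = gen_prod k @ gen (Suc k)"
  by (simp add: gen_prod_def gen_def)

lemma reduced_gen_prod [simp]: "reduced (gen_prod k)"
  unfolding gen_prod_def by (rule reduced_map_positive)

lemma gen_prod_words [simp]: "gen_prod k \<in> words n \<longleftrightarrow> k \<le> n"
  by (induction k) (auto simp: gen_prod_Suc)

lemma gen_prod_split: "j < k \<Longrightarrow> \<exists>v. gen_prod k = gen_prod j @ (Suc j, False) # v"
proof (induction k)
  case (Suc k)
  then show ?case by (cases "j = k") (auto simp: gen_prod_Suc gen_def)
qed simp

lemma z1_gen_prod: "z1 n = finv (gen_prod n)"
  by (simp only: z1_def gen_prod_def)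

lemma subst_gen_prod: "subst g (gen_prod k) = concat (map g [1..<Suc k])"
  by (induction k) (auto simp: gen_prod_Suc)

lemma free_eq_from_gen_prods:
  assumes "\<And>j. subst f (gen_prod j) \<approx> subst g (gen_prod j)"
  shows "f (Suc k) \<approx> g (Suc k)"
proof -
  have "subst f (gen_prod k) @ f (Suc k) \<approx> subst f (gen_prod k) @ g (Suc k)"
    using assms[of "Suc k"] append_free_cong[OF assms[of k] refl, of "g (Suc k)"]
    by (simp add: gen_prod_Suc)
  then show ?thesis by (simp only: append_free_eq_left_cancel)
qed

lemma subst_sigma_img_gen_prod_less:
  assumes "j < fst a"
  shows "subst (sigma_img a) (gen_prod j) = gen_prod j"
  using assms by (induction j) (simp_all add: gen_prod_Suc)

lemma subst_sigma_img_gen_prod_greater: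
  assumes "1 \<le> fst a" "fst a < j"
  shows "subst (sigma_img a) (gen_prod j) \<approx> gen_prod j"
proof -
  obtain m b where a: "a = (Suc m, b)"
    using assms(1) by (cases a; cases "fst a") auto
  from assms(2) have "Suc (Suc m) \<le> j" by (simp add: a)
  then show ?thesis
  proof (induction rule: dec_induct)
    case base
    have "subst (sigma_img a) (gen_prod (Suc (Suc m)))
        \<approx> gen_prod m @ sigma_img a (Suc m) @ sigma_img a (Suc (Suc m))"
      by (simp add: gen_prod_Suc subst_sigma_img_gen_prod_less a)
    also have "\<dots> = reduce (gen_prod (Suc (Suc m)))"
      by (cases b) (simp_all add: a gen_prod_Suc gen_def free_group_simps)
    finally show ?case .
  next
    case (step k)
    then show ?case
      using append_free_cong[OF step.IH refl, of "gen (Suc k)"] by (simp add: gen_prod_Suc a)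
  qed
qed

lemma subst_sigma_img_gen_prod_same:
  "subst (sigma_img (Suc m, False)) (gen_prod (Suc m))
     \<approx> gen_prod m @ finv (gen_prod (Suc m)) @ gen_prod (Suc (Suc m))"
  "subst (sigma_img (Suc m, True)) (gen_prod (Suc m))
     \<approx> gen_prod (Suc (Suc m)) @ finv (gen_prod (Suc m)) @ gen_prod m"
  by (simp_all add: gen_prod_Suc subst_sigma_img_gen_prod_less gen_def free_group_simps)

abbreviation conj_word :: "word \<Rightarrow> letter \<Rightarrow> word" where
  "conj_word P a \<equiv> P @ a # finv P"

lemma conj_word_Cons_normal_form:
  assumes "reduced (conj_word P a)"
  shows "\<exists>Q. reduce (conj_word (x # P) a) = conj_word Q a"
proof (cases P)
  case Nil
  show ?thesis
  proof (cases "fst x = fst a")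
    case True
    then have "reduce (conj_word (x # P) a) = conj_word [] a"
      using Nil fst_eq_imp_eq_or_flip[of x a] by (auto simp: reduce_Cons red_cons_Cons)
    then show ?thesis by blast
  next
    case False
    then have "reduced (conj_word [x] a)"
      by (metis append_Cons append_Nil finv_Cons finv_Nil fst_flip reduced.simps(2,3))
    then show ?thesis using Nil by (metis reduce_reduced)
  qed
next
  case (Cons y Q)
  show ?thesis
  proof (cases "y = flip x")
    case True
    have "reduced (conj_word Q a)"
      using assms reduced_append[of "y # Q @ a # finv Q" "[flip y]"] by (simp add: Cons reduced_Cons)
    moreover have "conj_word (x # P) a \<approx> conj_word Q a"
      using Cons True by (simp add: free_group_simps)
    ultimately show ?thesis by (metis reduce_reduced)
  next
    case False
    then have "reduced (x # conj_word P a)"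
      using assms Cons by (simp add: reduced_Cons)
    moreover have "last (x # conj_word P a) = flip y"
      using Cons by simp
    ultimately have "reduced ((x # conj_word P a) @ [flip x])"
      using False unfolding reduced_append by auto
    then show ?thesis by (metis append_Cons append_assoc finv_Cons reduce_reduced)
  qed
qed

lemma conj_word_normal_form: "\<exists>Q. reduce (conj_word P a) = conj_word Q a"
proof (induction P)
  case Nil
  then show ?case by (intro exI[of _ "[]"]) simp
next
  case (Cons x P)
  then obtain Q where Q: "reduce (conj_word P a) = conj_word Q a" by blast
  then have "reduced (conj_word Q a)" by (metis reduced_reduce)
  moreover have "conj_word (x # P) a \<approx> conj_word (x # Q) a"
    using append_free_cong[OF refl append_free_cong[OF free_eq_reduce[OF Q] refl], of "[x]" "[flip x]"]
    by simp
  ultimately show ?case by (metis conj_word_Cons_normal_form)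
qed

lemma signed_conj_word: "signed d (conj_word P (c, e)) = conj_word P (c, d \<noteq> e)"
  by (simp add: signed_def)

text \<open>The sign \<open>e\<close> is \<open>True\<close> for orientation-reversing maps: they send the generators to conjugates of
  inverse generators and \<open>t\<^sub>1 \<cdots> t\<^sub>n\<close> to its inverse.\<close>

definition braid_tuple :: "bool \<Rightarrow> nat \<Rightarrow> (nat \<Rightarrow> word) \<Rightarrow> bool" where
  "braid_tuple e n g \<longleftrightarrow>
     (\<forall>k\<in>{1..n}. g k \<in> words n \<and> (\<exists>P c. reduce (g k) = conj_word P (c, e)))
     \<and> reduce (subst g (gen_prod n)) = signed e (gen_prod n)"

lemma braid_tuple_subst:
  assumes f: "braid_tuple d n f" and g: "braid_tuple e n g"
  shows "braid_tuple (d \<noteq> e) n (\<lambda>k. subst g (f k))"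
proof -
  have "subst g (f k) \<in> words n \<and> (\<exists>P b. reduce (subst g (f k)) = conj_word P (b, d \<noteq> e))"
    if k: "k \<in> {1..n}" for k
  proof
    show "subst g (f k) \<in> words n"
      using f g k by (intro subst_words) (auto simp: braid_tuple_def)
    from f k obtain P c where P: "reduce (f k) = conj_word P (c, d)"
      unfolding braid_tuple_def by blast
    have "conj_word P (c, d) \<in> words n"
      using f k by (auto simp: braid_tuple_def simp flip: P)
    then have "c \<in> {1..n}" by simp
    with g obtain Q b where Q: "reduce (g c) = conj_word Q (b, e)"
      unfolding braid_tuple_def by blast
    have "signed d (g c) \<approx> signed d (conj_word Q (b, e))"
      using free_eq_reduce[OF Q] by (simp add: reduce_signed)
    then have g_c: "signed d (g c) \<approx> conj_word Q (b, d \<noteq> e)"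
      by (simp only: signed_conj_word)
    have "subst g (f k) \<approx> subst g (conj_word P (c, d))"
      by (rule subst_free_cong[OF free_eq_reduce[OF P]])
    also have "\<dots> = reduce (subst g P @ signed d (g c) @ finv (subst g P))"
      by simp
    also have "\<dots> = reduce (subst g P @ conj_word Q (b, d \<noteq> e) @ finv (subst g P))"
      by (intro append_free_cong refl g_c)
    also have "\<dots> = reduce (conj_word (subst g P @ Q) (b, d \<noteq> e))"
      by simp
    finally show "\<exists>P b. reduce (subst g (f k)) = conj_word P (b, d \<noteq> e)"
      using conj_word_normal_form by metis
  qed
  moreover have "subst g (subst f (gen_prod n)) \<approx> subst g (signed d (gen_prod n))"
    using f by (intro subst_free_cong free_eq_reduce) (simp add: braid_tuple_def)
  then have "reduce (subst (\<lambda>k. subst g (f k)) (gen_prod n)) = signed (d \<noteq> e) (gen_prod n)"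
    using g by (simp add: subst_subst reduce_signed braid_tuple_def)
  ultimately show ?thesis unfolding braid_tuple_def by blast
qed

lemma braid_tuple_sigma_img:
  assumes "fst a \<in> {1..n - 1}"
  shows "braid_tuple False n (sigma_img a)"
proof -
  obtain i s where a: "a = (i, s)" by (cases a)
  have "\<exists>P c. sigma_img a k = conj_word P (c, False)" for k
  proof -
    consider (gen) j where "sigma_img a k = gen j"
      | (same) "sigma_img a k = conj_word [(i, False)] (Suc i, False)"
      | (succ) "sigma_img a k = conj_word [(Suc i, True)] (i, False)"
      using a by (cases "k = i"; cases "k = Suc i"; cases s) auto
    then show ?thesis
    proof cases
      case (gen j)
      then have "sigma_img a k = conj_word [] (j, False)" by (simp add: gen_def)
      then show ?thesis by blast
    qed blast+
  qed
  then have "\<exists>P c. reduce (sigma_img a k) = conj_word P (c, False)" for k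
    using conj_word_normal_form by metis
  moreover have "subst (sigma_img a) (gen_prod n) \<approx> gen_prod n"
    using assms by (intro subst_sigma_img_gen_prod_greater) auto
  ultimately show ?thesis
    using sigma_img_words[OF assms] by (simp add: braid_tuple_def)
qed

section \<open>Products of conjugates without absorption\<close>

abbreviation letter_count :: "nat \<Rightarrow> word \<Rightarrow> nat" where
  "letter_count k w \<equiv> length (filter (\<lambda>a. fst a = k) w)"

lemma letter_count_finv [simp]: "letter_count k (finv w) = letter_count k w"
  by (induction w) auto

lemma letter_count_reduce: "letter_count k (reduce w) \<le> letter_count k w"
  by (rule list_emb_length[OF subseq_filter[OF subseq_reduce]])

lemma letter_count_gen_prod: "letter_count k (gen_prod n) = (if k \<in> {1..n} then 1 else 0)"
  by (induction n) (auto simp: gen_prod_Suc gen_def)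

definition no_absorption :: "word \<Rightarrow> nat \<Rightarrow> word \<Rightarrow> nat \<Rightarrow> bool" where
  "no_absorption P c P' c' \<longleftrightarrow> \<not> prefix (P @ [(c, True)]) P' \<and> \<not> prefix (P' @ [(c', False)]) P"

lemma reduce_conj_word_append:
  assumes P: "reduced (conj_word P (c, False))" and P': "reduced (P' @ (c', False) # w)"
    and "no_absorption P c P' c'"
  obtains M A B where "P = M @ A" "P' = M @ B"
    "reduce (conj_word P (c, False) @ P' @ (c', False) # w) = P @ (c, False) # finv A @ B @ (c', False) # w"
proof -
  obtain M A B where M: "P = M @ A" "P' = M @ B" "A = [] \<or> B = [] \<or> hd A \<noteq> hd B"
    using longest_common_prefix by blast
  have "reduced ((P @ (c, False) # finv A) @ finv M)"
    using P by (simp add: M(1))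
  then have left: "reduced (P @ (c, False) # finv A)"
    by (rule reduced_appendD)
  have "reduced (M @ B @ (c', False) # w)"
    using P' by (simp add: M(2))
  then have right: "reduced (B @ (c', False) # w)"
    by (rule reduced_appendD)
  have junction: "hd (B @ (c', False) # w) \<noteq> flip (last ((c, False) # finv A))"
  proof (cases "A = []")
    case True
    then have "B \<noteq> [] \<Longrightarrow> hd B \<noteq> (c, True)"
      using assms(3) M by (cases B) (auto simp: no_absorption_def)
    with True show ?thesis by (cases B) auto
  next
    case False
    then have "B = [] \<Longrightarrow> hd A \<noteq> (c', False)"
      using assms(3) M by (cases A) (auto simp: no_absorption_def)
    with False M(3) show ?thesis by (cases B) (auto simp: last_finv)
  qed
  have "reduced ((P @ (c, False) # finv A) @ B @ (c', False) # w)"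
    using left right junction unfolding reduced_append[of "P @ (c, False) # finv A"] by auto
  moreover have "conj_word P (c, False) @ P' @ (c', False) # w
      \<approx> (P @ (c, False) # finv A) @ B @ (c', False) # w"
    by (simp add: M(1,2) free_group_simps)
  ultimately have "reduce (conj_word P (c, False) @ P' @ (c', False) # w)
      = P @ (c, False) # finv A @ B @ (c', False) # w"
    by simp
  with M(1,2) show thesis by (rule that)
qed

definition conj_product :: "(nat \<Rightarrow> word) \<Rightarrow> (nat \<Rightarrow> nat) \<Rightarrow> nat \<Rightarrow> nat \<Rightarrow> word" where
  "conj_product P c m n = concat (map (\<lambda>i. conj_word (P i) (c i, False)) [m..<Suc n])"

lemma conj_product_Cons:
  "m \<le> n \<Longrightarrow> conj_product P c m n = conj_word (P m) (c m, False) @ conj_product P c (Suc m) n"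
  by (simp add: conj_product_def upt_conv_Cons[of m "Suc n"] del: upt_Suc)

lemma conj_product_empty [simp]: "conj_product P c (Suc n) n = []"
  by (simp add: conj_product_def)

definition tight :: "(nat \<Rightarrow> word) \<Rightarrow> (nat \<Rightarrow> nat) \<Rightarrow> nat \<Rightarrow> nat \<Rightarrow> bool" where
  "tight P c m n \<longleftrightarrow> (\<forall>i\<in>{m..n}. reduced (conj_word (P i) (c i, False)))
     \<and> (\<forall>i\<in>{m..<n}. no_absorption (P i) (c i) (P (Suc i)) (c (Suc i)))"

lemma tight_mono: "tight P c m n \<Longrightarrow> m \<le> m' \<Longrightarrow> tight P c m' n"
  by (auto simp: tight_def)

lemma reduce_tight_product:
  assumes "m \<le> n" "tight P c m n"
  shows "\<exists>w. reduce (conj_product P c m n) = P m @ (c m, False) # w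
    \<and> (\<forall>k. letter_count k (P m) \<le> letter_count k w)"
  using assms
proof (induction rule: inc_induct)
  case base
  then show ?case
    by (intro exI[of _ "finv (P n)"]) (simp add: conj_product_Cons tight_def)
next
  case (step m)
  obtain w where w: "reduce (conj_product P c (Suc m) n) = P (Suc m) @ (c (Suc m), False) # w"
      and w_count: "\<forall>k. letter_count k (P (Suc m)) \<le> letter_count k w"
    using step.IH tight_mono[OF step.prems, of "Suc m"] by auto
  obtain M A B where M: "P m = M @ A" "P (Suc m) = M @ B"
    and product: "reduce (conj_word (P m) (c m, False) @ P (Suc m) @ (c (Suc m), False) # w)
      = P m @ (c m, False) # finv A @ B @ (c (Suc m), False) # w"
  proof (rule reduce_conj_word_append)
    show "reduced (conj_word (P m) (c m, False))"
      and "no_absorption (P m) (c m) (P (Suc m)) (c (Suc m))"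
      using step by (simp_all add: tight_def)
    show "reduced (P (Suc m) @ (c (Suc m), False) # w)"
      using reduced_reduce[of "conj_product P c (Suc m) n"] unfolding w .
  qed
  let ?w = "finv A @ B @ (c (Suc m), False) # w"
  have "reduce (conj_product P c m n)
      = reduce (conj_word (P m) (c m, False) @ conj_product P c (Suc m) n)"
    using step.hyps by (simp only: conj_product_Cons)
  also have "\<dots> = reduce (conj_word (P m) (c m, False) @ P (Suc m) @ (c (Suc m), False) # w)"
    by (rule append_free_cong[OF refl free_eq_reduce[OF w]])
  finally have "reduce (conj_product P c m n) = P m @ (c m, False) # ?w"
    using product by simp
  moreover have "letter_count k (P m) \<le> letter_count k ?w" for k
    using spec[OF w_count, of k] by (simp add: M)
  ultimately show ?case by blast
qed

lemma tight_product_head: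
  assumes "m \<le> n" "tight P c m n"
    and product: "reduce (conj_product P c m n) = map (\<lambda>i. (i, False)) [m..<Suc n]"
  shows "P m = []" "c m = m"
proof -
  let ?v = "map (\<lambda>i. (i, False)) [Suc m..<Suc n]"
  have cons: "map (\<lambda>i. (i, False)) [m..<Suc n] = (m, False) # ?v"
    using assms(1) by (simp add: upt_conv_Cons[of m "Suc n"] del: upt_Suc)
  obtain w where w: "(m, False) # ?v = P m @ (c m, False) # w"
      and w_count: "\<forall>k. letter_count k (P m) \<le> letter_count k w"
    using reduce_tight_product[OF assms(1,2)] unfolding product cons by blast
  show "P m = []"
  proof (rule ccontr)
    assume "P m \<noteq> []"
    with w obtain R where R: "P m = (m, False) # R" "?v = R @ (c m, False) # w"
      by (cases "P m") auto
    have "letter_count m ?v = 0"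
      by (auto simp: filter_empty_conv simp del: upt_Suc)
    moreover have "letter_count m w \<le> letter_count m ?v"
      unfolding R(2) by simp
    moreover have "1 \<le> letter_count m (P m)"
      unfolding R(1) by simp
    ultimately show False
      using spec[OF w_count, of m] by linarith
  qed
  with w show "c m = m" by simp
qed

lemma tight_product_eq_gen_prod:
  assumes tight: "tight P c 1 n" and product: "reduce (conj_product P c 1 n) = gen_prod n"
    and i: "i \<in> {1..n}"
  shows "P i = []" "c i = i"
proof -
  have suffix: "reduce (conj_product P c m n) = map (\<lambda>i. (i, False)) [m..<Suc n]" if "1 \<le> m" "m \<le> n" for m
    using that
  proof (induction rule: dec_induct)
    case base
    then show ?case using product by (simp only: gen_prod_def)
  next
    case (step m)
    then have m: "m \<le> n" and IH: "reduce (conj_product P c m n) = map (\<lambda>i. (i, False)) [m..<Suc n]"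
      by simp_all
    have "P m = []" "c m = m"
      using tight_product_head[OF m tight_mono[OF tight step.hyps(1)] IH] by simp_all
    then have "[(m, False)] @ conj_product P c (Suc m) n
        \<approx> [(m, False)] @ map (\<lambda>i. (i, False)) [Suc m..<Suc n]"
      using IH m reduced_map_positive[of id "[m..<Suc n]"]
      by (simp add: conj_product_Cons upt_conv_Cons[of m "Suc n"] del: upt_Suc)
    then have "conj_product P c (Suc m) n \<approx> map (\<lambda>i. (i, False)) [Suc m..<Suc n]"
      by (simp only: append_free_eq_left_cancel)
    then show ?case
      by (simp only: reduce_reduced[OF reduced_map_positive])
  qed
  have "1 \<le> i" "i \<le> n" using i by simp_all
  then show "P i = []" "c i = i"
    using tight_product_head[OF _ tight_mono[OF tight] suffix] by simp_all
qed

lemma positive_absorption_remainder: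
  assumes y: "reduce y = P @ (c, True) # u" and product: "t # v \<approx> conj_word P (c, False) @ y"
    and R: "P @ [(c, False)] = t # R"
  shows "(c, True) # u = reduce (finv R @ v)"
proof -
  have "reduced (P @ (c, True) # u)"
    using reduced_reduce[of y] unfolding y .
  then have "reduced ((c, True) # u)"
    by (rule reduced_appendD)
  then have "(c, True) # u = reduce ((c, True) # u)"
    by (rule reduce_reduced[symmetric])
  also have "\<dots> = reduce (finv P @ P @ (c, True) # u)"
    by (rule finv_append_cancel[symmetric])
  also have "\<dots> = reduce (finv P @ y)"
    by (rule append_free_cong[OF refl free_eq_reduce[OF y, symmetric]])
  also have "\<dots> = reduce (finv (P @ [(c, False)]) @ conj_word P (c, False) @ y)"
    by (simp add: free_group_simps)
  also have "\<dots> = reduce (finv (t # R) @ t # v)"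
    unfolding R by (rule append_free_cong[OF refl product[symmetric]])
  also have "\<dots> = reduce (finv R @ v)"
    by (simp add: free_group_simps)
  finally show ?thesis .
qed

text \<open>Write \<open>P\<^sub>1 c\<^sub>1 = t\<^sub>1 R\<close>. If \<open>P\<^sub>2 = P\<^sub>1 c\<^sub>1\<^sup>-\<^sup>1 Q\<close>, the reduced word \<open>c\<^sub>1\<^sup>-\<^sup>1 Q c\<^sub>2 w\<close> equals
  \<open>R\<^sup>-\<^sup>1 t\<^sub>2 \<cdots> t\<^sub>n\<close>. But by tightness \<open>w\<close> contains at least as many letters \<open>t\<^sub>1\<^sup>\<plusminus>\<^sup>1\<close> as \<open>P\<^sub>2\<close>, which has
  more of them than \<open>R\<close>.\<close>

lemma no_positive_absorption_at_first:
  assumes n: "2 \<le> n" and tight: "tight P c 2 n"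
    and product: "reduce (conj_product P c 1 n) = gen_prod n"
    and start: "prefix (gen 1) (conj_word (P 1) (c 1, False))"
  shows "\<not> prefix (P 1 @ [(c 1, True)]) (P 2)"
proof
  assume "prefix (P 1 @ [(c 1, True)]) (P 2)"
  then obtain Q where Q: "P 2 = P 1 @ (c 1, True) # Q" by (auto simp: prefix_def)
  obtain w where w: "reduce (conj_product P c 2 n) = P 2 @ (c 2, False) # w"
      and w_count: "\<forall>k. letter_count k (P 2) \<le> letter_count k w"
    using reduce_tight_product[OF n tight] by blast
  obtain R where R: "P 1 @ [(c 1, False)] = (1, False) # R"
    using start by (cases "P 1") (auto simp: gen_def)
  obtain v where v: "gen_prod n = (1, False) # v"
    using gen_prod_split[of 0 n] n by auto
  let ?u = "(c 1, True) # Q @ (c 2, False) # w"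
  have "(1, False) # v \<approx> conj_word (P 1) (c 1, False) @ conj_product P c 2 n"
    using product conj_product_Cons[of 1 n P c] n reduced_gen_prod[of n]
    unfolding v numeral_2_eq_2 by simp
  then have "?u = reduce (finv R @ v)"
    using w R unfolding Q by (intro positive_absorption_remainder) simp_all
  then have "letter_count 1 ?u \<le> letter_count 1 (finv R @ v)"
    using letter_count_reduce[of 1 "finv R @ v"] by (simp only:)
  moreover have "letter_count 1 v = 0"
    using letter_count_gen_prod[of 1 n] n unfolding v by simp
  moreover have "letter_count 1 (P 1 @ [(c 1, False)]) = Suc (letter_count 1 R)"
    unfolding R by simp
  ultimately show False
    using spec[OF w_count, of 1] unfolding Q by (simp split: if_splits)
qed

lemma negative_absorption_at_first:
  assumes reduced: "\<forall>i\<in>{1..n}. reduced (conj_word (P i) (c i, False))" and tight: "tight P c 2 n"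
    and product: "reduce (conj_product P c 1 n) = gen_prod n"
    and start: "prefix (gen 1) (conj_word (P 1) (c 1, False))"
    and nontrivial: "i \<in> {1..n}" "\<not> (P i = [] \<and> c i = i)"
  shows "2 \<le> n" "prefix (P 2 @ [(c 2, False)]) (P 1)"
proof -
  have "\<not> tight P c 1 n"
    using tight_product_eq_gen_prod[OF _ product nontrivial(1)] nontrivial(2) by blast
  then obtain j where j: "j \<in> {1..<n}" "\<not> no_absorption (P j) (c j) (P (Suc j)) (c (Suc j))"
    using reduced by (auto simp: tight_def)
  moreover have "\<not> 2 \<le> j"
    using j tight by (auto simp: tight_def)
  ultimately have "j = 1" by auto
  with j show "2 \<le> n" by simp
  with no_positive_absorption_at_first[OF _ tight product start] j \<open>j = 1\<close>
  show "prefix (P 2 @ [(c 2, False)]) (P 1)"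
    by (auto simp: no_absorption_def numeral_2_eq_2)
qed

section \<open>Descent\<close>

definition split_off :: "nat \<times> bool \<Rightarrow> (nat \<Rightarrow> word) \<Rightarrow> nat \<Rightarrow> word" where
  "split_off a g k = subst g (sigma_img (flip a) k)"

lemma split_off_other [simp]: "k \<noteq> fst a \<Longrightarrow> k \<noteq> Suc (fst a) \<Longrightarrow> split_off a g k = g k"
  by (simp add: split_off_def)

lemma braid_tuple_split_off:
  assumes "braid_tuple e n g" "fst a \<in> {1..n - 1}"
  shows "braid_tuple e n (split_off a g)"
proof -
  have "braid_tuple False n (sigma_img (flip a))"
    using assms(2) by (intro braid_tuple_sigma_img) simp
  from braid_tuple_subst[OF this assms(1)] show ?thesis
    by (simp add: split_off_def[abs_def])
qed

lemma braid_img_Cons_split_off: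
  assumes a: "fst a \<in> {1..n - 1}" and k: "k \<in> {1..n}"
    and ws: "\<And>k. k \<in> {1..n} \<Longrightarrow> split_off a g k \<approx> braid_img ws k"
  shows "g k \<approx> braid_img (a # ws) k"
proof -
  have "g k \<approx> subst g (subst (sigma_img (flip a)) (sigma_img a k))"
    using subst_free_cong[OF subst_sigma_img_flip[of a "gen k"], of g] by simp
  also have "\<dots> = reduce (subst (split_off a g) (sigma_img a k))"
    by (simp add: subst_subst split_off_def[abs_def])
  also have "\<dots> = reduce (subst (braid_img ws) (sigma_img a k))"
    using sigma_img_words[OF a k] by (intro subst_free_cong_img ws) (auto simp: words_def)
  finally show ?thesis by simp
qed

definition total_length :: "nat \<Rightarrow> (nat \<Rightarrow> word) \<Rightarrow> nat" where
  "total_length n g = (\<Sum>k=1..n. length (reduce (g k)))"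

lemma total_length_less:
  assumes i: "i \<in> {1..<n}" and other: "\<And>k. k \<noteq> i \<Longrightarrow> k \<noteq> Suc i \<Longrightarrow> h k \<approx> g k"
    and less: "length (reduce (h i)) + length (reduce (h (Suc i)))
      < length (reduce (g i)) + length (reduce (g (Suc i)))"
  shows "total_length n h < total_length n g"
proof -
  have split: "{1..n} = insert i (insert (Suc i) ({1..n} - {i, Suc i}))"
    using i by auto
  have "(\<Sum>k\<in>{1..n} - {i, Suc i}. length (reduce (h k)))
      = (\<Sum>k\<in>{1..n} - {i, Suc i}. length (reduce (g k)))"
    by (intro sum.cong) (auto simp: other)
  then show ?thesis
    unfolding total_length_def by (subst (1 2) split) (use less in simp)
qed

lemma length_conjugate_less:
  assumes "reduce u = conj_word P a" "reduce v = conj_word (P @ a # Q) b"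
  shows "length (reduce (finv u @ v @ u)) < length (reduce v)"
proof -
  note u = free_eq_reduce[OF assms(1)] and v = free_eq_reduce[OF assms(2)]
  have "finv u @ v @ u \<approx> finv (conj_word P a) @ conj_word (P @ a # Q) b @ conj_word P a"
    by (intro append_free_cong[OF finv_free_cong[OF u] append_free_cong[OF v u]])
  also have "\<dots> = reduce (conj_word (P @ Q) b)"
    by (simp add: free_group_simps)
  finally have "length (reduce (finv u @ v @ u)) \<le> length (conj_word (P @ Q) b)"
    by (simp only: length_reduce)
  then show ?thesis by (simp add: assms(2))
qed

lemma positive_absorption_shortens:
  assumes i: "i \<in> {1..<n}"
    and g: "reduce (g i) = conj_word P (c, False)" "reduce (g (Suc i)) = conj_word P' (c', False)"
    and absorption: "prefix (P @ [(c, True)]) P'"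
  shows "total_length n (split_off (i, False) g) < total_length n g"
proof (rule total_length_less[OF i])
  obtain Q where "P' = P @ (c, True) # Q"
    using absorption by (auto simp: prefix_def)
  with g have "length (reduce (finv (finv (g i)) @ g (Suc i) @ finv (g i))) < length (reduce (g (Suc i)))"
    by (intro length_conjugate_less[of _ P "(c, True)" _ Q]) (simp_all add: reduce_finv)
  then show "length (reduce (split_off (i, False) g i)) + length (reduce (split_off (i, False) g (Suc i)))
      < length (reduce (g i)) + length (reduce (g (Suc i)))"
    by (simp add: split_off_def)
qed simp

lemma negative_absorption_shortens:
  assumes i: "i \<in> {1..<n}"
    and g: "reduce (g i) = conj_word P (c, False)" "reduce (g (Suc i)) = conj_word P' (c', False)"
    and absorption: "prefix (P' @ [(c', False)]) P"
  shows "total_length n (split_off (i, True) g) < total_length n g"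
proof (rule total_length_less[OF i])
  obtain Q where "P = P' @ (c', False) # Q"
    using absorption by (auto simp: prefix_def)
  with g have "length (reduce (finv (g (Suc i)) @ g i @ g (Suc i))) < length (reduce (g i))"
    by (intro length_conjugate_less[of _ P' "(c', False)" _ Q]) simp_all
  then show "length (reduce (split_off (i, True) g i)) + length (reduce (split_off (i, True) g (Suc i)))
      < length (reduce (g i)) + length (reduce (g (Suc i)))"
    by (simp add: split_off_def)
qed simp

lemma absorption_shortens:
  assumes "i \<in> {1..<n}"
    and "reduce (g i) = conj_word P (c, False)" "reduce (g (Suc i)) = conj_word P' (c', False)"
    and "\<not> no_absorption P c P' c'"
  shows "\<exists>s. total_length n (split_off (i, s) g) < total_length n g"
  using assms(4) positive_absorption_shortens[OF assms(1-3)] negative_absorption_shortens[OF assms(1-3)]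
  unfolding no_absorption_def by blast

lemma braid_tuple_conj_product:
  assumes "braid_tuple False n g"
  obtains P c where "\<forall>i\<in>{1..n}. reduce (g i) = conj_word (P i) (c i, False)"
    "\<forall>i\<in>{1..n}. reduced (conj_word (P i) (c i, False))"
    "reduce (conj_product P c 1 n) = gen_prod n"
proof -
  have "\<forall>i\<in>{1..n}. \<exists>x. reduce (g i) = conj_word (fst x) (snd x, False)"
    using assms unfolding braid_tuple_def by (metis fst_conv snd_conv)
  then obtain x where x: "\<forall>i\<in>{1..n}. reduce (g i) = conj_word (fst (x i)) (snd (x i), False)"
    by (rule bchoice[THEN exE])
  define P where "P i = fst (x i)" for i
  define c where "c i = snd (x i)" for i
  have g: "\<forall>i\<in>{1..n}. reduce (g i) = conj_word (P i) (c i, False)"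
    using x by (simp add: P_def c_def)
  moreover have "reduced (conj_word (P i) (c i, False))" if "i \<in> {1..n}" for i
    using reduced_reduce[of "g i"] unfolding bspec[OF g that] .
  moreover have "subst g (gen_prod n) \<approx> subst (\<lambda>i. conj_word (P i) (c i, False)) (gen_prod n)"
    using gen_prod_words[of n n]
    by (intro subst_free_cong_img free_eq_reduce bspec[OF g]) (auto simp: words_def simp del: gen_prod_words)
  then have "reduce (conj_product P c 1 n) = gen_prod n"
    using assms by (simp only: subst_gen_prod conj_product_def braid_tuple_def signed_simps)
  ultimately show thesis using that by blast
qed

lemma shortening_letter_exists:
  assumes tup: "braid_tuple False n g" and start: "prefix (gen 1) (reduce (g 1))"
    and nontrivial: "k \<in> {1..n}" "\<not> g k \<approx> gen k"
  obtains a where "fst a \<in> {1..n - 1}" "a \<noteq> (1, False)"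
    "total_length n (split_off a g) < total_length n g" "prefix (gen 1) (reduce (split_off a g 1))"
proof -
  obtain P c where g: "\<forall>i\<in>{1..n}. reduce (g i) = conj_word (P i) (c i, False)"
    and reduced: "\<forall>i\<in>{1..n}. reduced (conj_word (P i) (c i, False))"
    and product: "reduce (conj_product P c 1 n) = gen_prod n"
    by (rule braid_tuple_conj_product[OF tup])
  show thesis
  proof (cases "tight P c 2 n")
    case False
    then obtain i where i: "i \<in> {2..<n}" "\<not> no_absorption (P i) (c i) (P (Suc i)) (c (Suc i))"
      using reduced by (auto simp: tight_def)
    then obtain s where "total_length n (split_off (i, s) g) < total_length n g"
      using absorption_shortens[of i n g "P i" "c i"] g by force
    with i start show thesis by (intro that[of "(i, s)"]) auto
  next
    case True
    have g_1: "reduce (g 1) = conj_word (P 1) (c 1, False)"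
      using g nontrivial(1) by simp
    have "\<not> (P k = [] \<and> c k = k)"
      using bspec[OF g nontrivial(1)] nontrivial(2) by (auto simp: gen_def)
    note absorption =
      negative_absorption_at_first[OF reduced True product start[unfolded g_1] nontrivial(1) this]
    have g_2: "reduce (g (Suc 1)) = conj_word (P 2) (c 2, False)"
      using g absorption(1) by (simp add: numeral_2_eq_2)
    have "total_length n (split_off (1, True) g) < total_length n g"
      using absorption(1) by (intro negative_absorption_shortens[OF _ g_1 g_2 absorption(2)]) simp
    moreover obtain Q where "P 1 = P 2 @ (c 2, False) # Q"
      using absorption(2) by (auto simp: prefix_def)
    with start g_1 have "prefix (gen 1) (conj_word (P 2) (c 2, False))"
      by (cases "P 2") (auto simp: gen_def)
    then have "prefix (gen 1) (reduce (split_off (1, True) g 1))"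
      using g_2 by (simp add: split_off_def)
    ultimately show thesis
      using absorption(1) by (intro that[of "(1, True)"]) auto
  qed
qed

lemma braid_tuple_nonpos:
  assumes "braid_tuple False n g" "prefix (gen 1) (reduce (g 1))"
  shows "\<exists>ws\<in>nonpos_words n. \<forall>k\<in>{1..n}. g k \<approx> braid_img ws k"
  using assms
proof (induction "total_length n g" arbitrary: g rule: less_induct)
  case less
  show ?case
  proof (cases "\<forall>k\<in>{1..n}. g k \<approx> gen k")
    case True
    then show ?thesis by (intro bexI[of _ "[]"]) auto
  next
    case False
    then obtain a where a: "fst a \<in> {1..n - 1}" "a \<noteq> (1, False)"
      and shorter: "total_length n (split_off a g) < total_length n g"
      and start: "prefix (gen 1) (reduce (split_off a g 1))"
      using shortening_letter_exists[OF less.prems] by blast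
    from less.hyps[OF shorter braid_tuple_split_off[OF less.prems(1) a(1)] start]
    obtain ws where ws: "ws \<in> nonpos_words n" "\<forall>k\<in>{1..n}. split_off a g k \<approx> braid_img ws k"
      by blast
    then have "\<forall>k\<in>{1..n}. g k \<approx> braid_img (a # ws) k"
      using braid_img_Cons_split_off[OF a(1)] by blast
    moreover have "a # ws \<in> nonpos_words n"
      using a ws(1) by simp
    ultimately show ?thesis by blast
  qed
qed

section \<open>The mirror involution\<close>

text \<open>In the basis \<open>x\<^sub>k = t\<^sub>1 \<cdots> t\<^sub>k\<close> the mirror inverts every basis element.\<close>

definition mirror_img :: "nat \<Rightarrow> word" where
  "mirror_img k = conj_word (gen_prod (k - 1)) (k, True)"

lemma subst_mirror_gen_prod: "subst mirror_img (gen_prod k) \<approx> finv (gen_prod k)"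
proof (induction k)
  case (Suc k)
  have "subst mirror_img (gen_prod (Suc k)) \<approx> finv (gen_prod k) @ mirror_img (Suc k)"
    using append_free_cong[OF Suc.IH refl] by (simp add: gen_prod_Suc)
  also have "\<dots> = reduce (finv (gen_prod (Suc k)))"
    by (simp add: mirror_img_def gen_prod_Suc gen_def)
  finally show ?case .
qed simp

lemma subst_mirror_mirror: "subst mirror_img (subst mirror_img w) \<approx> w"
proof (rule subst_left_inverse)
  show "subst mirror_img (mirror_img k) \<approx> gen k" for k
  proof (cases k)
    case 0
    then show ?thesis by (simp add: mirror_img_def gen_def)
  next
    case (Suc m)
    have "subst (\<lambda>k. subst mirror_img (mirror_img k)) (gen_prod j) \<approx> subst gen (gen_prod j)" for j
    proof -
      have "subst mirror_img (subst mirror_img (gen_prod j)) \<approx> subst mirror_img (finv (gen_prod j))"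
        by (rule subst_free_cong[OF subst_mirror_gen_prod])
      also have "\<dots> = reduce (gen_prod j)"
        by (simp add: reduce_finv subst_mirror_gen_prod)
      finally show ?thesis by (simp add: subst_subst)
    qed
    then show ?thesis unfolding Suc by (rule free_eq_from_gen_prods)
  qed
qed

lemma braid_tuple_mirror_img: "braid_tuple True n mirror_img"
proof -
  have "mirror_img k \<in> words n" if "k \<in> {1..n}" for k
    using that by (auto simp: mirror_img_def)
  moreover have "\<exists>P c. reduce (mirror_img k) = conj_word P (c, True)" for k
    using conj_word_normal_form unfolding mirror_img_def by blast
  ultimately show ?thesis
    by (auto simp: braid_tuple_def subst_mirror_gen_prod)
qed

lemma subst_sigma_img_mirror_gen_prod:
  assumes "1 \<le> fst a"
  shows "subst (sigma_img a) (subst mirror_img (gen_prod j))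
    \<approx> subst mirror_img (subst (sigma_img (flip a)) (gen_prod j))"
proof -
  obtain m s where a: "a = (Suc m, s)"
    using assms by (cases a; cases "fst a") auto
  have "subst (sigma_img a) (subst mirror_img (gen_prod j)) \<approx> finv (subst (sigma_img a) (gen_prod j))"
    using subst_free_cong[OF subst_mirror_gen_prod] by simp
  also have "\<dots> = reduce (subst mirror_img (subst (sigma_img (flip a)) (gen_prod j)))"
  proof (cases "j = Suc m")
    case True
    have "subst mirror_img (gen_prod i @ finv (gen_prod (Suc m)) @ gen_prod l)
        \<approx> finv (gen_prod i) @ gen_prod (Suc m) @ finv (gen_prod l)" for i l
      by (simp, intro append_free_cong subst_mirror_gen_prod) (simp add: reduce_finv subst_mirror_gen_prod)
    with True a show ?thesis
      using subst_sigma_img_gen_prod_same[of m, THEN finv_free_cong]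
        subst_sigma_img_gen_prod_same[of m, THEN subst_free_cong, of mirror_img]
      by (cases s) simp_all
  next
    case False
    then have fixed: "subst (sigma_img b) (gen_prod j) \<approx> gen_prod j" if "fst b = Suc m" for b
      using subst_sigma_img_gen_prod_less[of j b] subst_sigma_img_gen_prod_greater[of b j] that
      by (cases "j < Suc m") auto
    show ?thesis
      using finv_free_cong[OF fixed[of a]] subst_free_cong[OF fixed[of "flip a"], of mirror_img]
        subst_mirror_gen_prod[of j] a by simp
  qed
  finally show ?thesis .
qed

lemma subst_sigma_img_mirror:
  assumes "1 \<le> fst a"
  shows "subst (sigma_img a) (subst mirror_img w) \<approx> subst mirror_img (subst (sigma_img (flip a)) w)"
proof -
  let ?l = "\<lambda>k. subst (sigma_img a) (mirror_img k)" and ?r = "\<lambda>k. subst mirror_img (sigma_img (flip a) k)"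
  have "?l k \<approx> ?r k" for k
  proof (cases k)
    case 0
    then show ?thesis using assms by (simp add: mirror_img_def gen_def)
  next
    case (Suc j)
    have "subst ?l (gen_prod i) \<approx> subst ?r (gen_prod i)" for i
      using subst_sigma_img_mirror_gen_prod[OF assms, of i] by (simp only: subst_subst)
    then show ?thesis unfolding Suc by (rule free_eq_from_gen_prods)
  qed
  then have "subst ?l w \<approx> subst ?r w"
    by (intro subst_free_cong_img)
  then show ?thesis by (simp only: subst_subst)
qed

lemma subst_braid_img_mirror:
  assumes "ws \<in> words n"
  shows "subst (braid_img ws) (subst mirror_img w) \<approx> subst mirror_img (subst (braid_img (map flip ws)) w)"
  using assms
proof (induction ws arbitrary: w)
  case (Cons a ws)
  then have "subst (braid_img ws) (subst (sigma_img a) (subst mirror_img w))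
      \<approx> subst (braid_img ws) (subst mirror_img (subst (sigma_img (flip a)) w))"
    by (intro subst_free_cong subst_sigma_img_mirror) simp
  with Cons show ?case
    by (simp add: subst_braid_img_Cons del: braid_img.simps)
qed simp

inductive gen_prod_head :: "word \<Rightarrow> word \<Rightarrow> bool" where
  empty: "gen_prod_head [] []"
| positive: "(v \<noteq> [] \<longrightarrow> hd v \<noteq> (Suc k, False)) \<Longrightarrow> gen_prod_head ((k, False) # y) (gen_prod k @ v)"
| negative: "u \<noteq> [] \<Longrightarrow> hd u \<in> {(k, True), (Suc k, False)} \<Longrightarrow> gen_prod_head ((k, True) # y) u"

lemma gen_prod_ends:
  assumes "1 \<le> k"
  shows "gen_prod k \<noteq> []" "hd (gen_prod k) = (1, False)" "last (gen_prod k) = (k, False)"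
  using assms by (simp_all add: gen_prod_def hd_map last_map del: upt_Suc)

lemma finv_gen_prod_append_gen_prod:
  assumes k: "1 \<le> k" "k \<noteq> l" and v: "reduced (gen_prod l @ v)" "v \<noteq> [] \<longrightarrow> hd v \<noteq> (Suc l, False)"
  defines "u \<equiv> reduce (finv (gen_prod k) @ gen_prod l @ v)"
  shows "u \<noteq> [] \<and> hd u \<in> {(k, True), (Suc k, False)}"
proof (cases "k < l")
  case True
  then obtain s where s: "gen_prod l = gen_prod k @ (Suc k, False) # s"
    using gen_prod_split by blast
  with v(1) have "reduced ((Suc k, False) # s @ v)"
    using reduced_appendD(2)[of "gen_prod k"] by simp
  then have "u = (Suc k, False) # s @ v"
    by (simp add: u_def s)
  then show ?thesis by simp
next
  case False
  then obtain s where s: "gen_prod k = gen_prod l @ (Suc l, False) # s"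
    using gen_prod_split[of l k] k(2) by auto
  let ?x = "(Suc l, False) # s"
  have "reduced ?x"
    using reduced_gen_prod[of k] unfolding s by (rule reduced_appendD)
  then have "reduced (finv ?x @ v)"
    unfolding reduced_append[of "finv ?x"] reduced_finv
    using reduced_appendD(2)[OF v(1)] v(2) by simp
  moreover have "u = reduce (finv ?x @ v)"
    by (simp add: u_def s free_group_simps)
  ultimately have "u = finv ?x @ v"
    by (simp only: reduce_reduced)
  moreover have "hd (finv ?x) = (k, True)"
    using gen_prod_ends(3)[OF k(1)] hd_finv[of ?x] unfolding s by simp
  ultimately have "u \<noteq> []" "hd u = (k, True)"
    using hd_append2[of "finv ?x" v] by auto
  then show ?thesis by simp
qed

lemma gen_prod_head_Cons_positive:
  assumes k: "1 \<le> k" and head: "gen_prod_head y u" and u: "reduced u"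
    and y: "y \<noteq> [] \<Longrightarrow> hd y \<noteq> (k, True) \<and> 1 \<le> fst (hd y)"
  shows "gen_prod_head ((k, False) # y) (reduce (gen_prod k @ u))"
proof -
  have hd_u: "u \<noteq> [] \<longrightarrow> hd u \<notin> {(k, True), (Suc k, False)}"
    using head by cases (use k y in \<open>auto simp: gen_prod_ends\<close>)
  then have "reduced (gen_prod k @ u)"
    unfolding reduced_append using u k by (simp add: gen_prod_ends)
  then show ?thesis
    using hd_u by (simp add: gen_prod_head.positive)
qed

lemma gen_prod_head_Cons_negative:
  assumes k: "1 \<le> k" and head: "gen_prod_head y u" and u: "reduced u"
    and y: "y \<noteq> [] \<Longrightarrow> hd y \<noteq> (k, False) \<and> 1 \<le> fst (hd y)"
  shows "gen_prod_head ((k, True) # y) (reduce (finv (gen_prod k) @ u))"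
proof -
  have cancel_free: ?thesis if "u \<noteq> [] \<longrightarrow> hd u \<noteq> (1, False)"
  proof -
    have "reduced (finv (gen_prod k) @ u)"
      unfolding reduced_append using u k that by (simp add: last_finv gen_prod_ends)
    then have "reduce (finv (gen_prod k) @ u) = finv (gen_prod k) @ u"
      by (rule reduce_reduced)
    then show ?thesis
      using k by (intro gen_prod_head.negative) (simp_all add: gen_prod_ends hd_finv)
  qed
  from head show ?thesis
  proof cases
    case (positive v l y')
    then have "k \<noteq> l" using y by auto
    then show ?thesis
      using finv_gen_prod_append_gen_prod[OF k, of l v] positive u
      by (intro gen_prod_head.negative) simp_all
  qed (use cancel_free y in auto)
qed

lemma gen_prod_head_subst:
  assumes "reduced y" "y \<in> words n"
  shows "gen_prod_head y (reduce (subst gen_prod y))"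
  using assms
proof (induction y)
  case Nil
  then show ?case by (simp add: gen_prod_head.empty)
next
  case (Cons a y)
  obtain k b where a: "a = (k, b)" by (cases a)
  let ?u = "reduce (subst gen_prod y)"
  have k: "1 \<le> k" and y: "y \<noteq> [] \<Longrightarrow> hd y \<noteq> (k, \<not> b) \<and> 1 \<le> fst (hd y)"
    using Cons.prems a by (auto simp: reduced_Cons neq_Nil_conv)
  have head: "gen_prod_head y ?u"
    using Cons by (simp add: reduced_Cons)
  have "reduce (subst gen_prod (a # y)) = reduce (signed b (gen_prod k) @ ?u)"
    using a by simp
  also have "gen_prod_head (a # y) \<dots>"
    using gen_prod_head_Cons_positive[OF k head reduced_reduce]
      gen_prod_head_Cons_negative[OF k head reduced_reduce] y a
    by (cases b) simp_all
  finally show ?case .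
qed

lemma gen_prod_coordinates:
  assumes "w \<in> words n"
  obtains y where "reduced y" "y \<in> words n" "subst gen_prod y \<approx> w"
proof -
  define coords where "coords k = (if k = 1 then [(1, False)] else [(k - 1, True), (k, False)])" for k :: nat
  have "subst gen_prod (coords k) \<approx> gen k" if k: "k \<in> {1..n}" for k
  proof -
    obtain j where "k = Suc j" using k by (cases k) auto
    then show ?thesis by (cases j) (auto simp: coords_def gen_prod_Suc gen_def free_group_simps)
  qed
  then have "subst (\<lambda>k. subst gen_prod (coords k)) w \<approx> subst gen w"
    using assms by (intro subst_free_cong_img) (auto simp: words_def)
  then have "subst gen_prod (reduce (subst coords w)) \<approx> w"
    by (simp add: subst_subst)
  moreover have "subst coords w \<in> words n"
    by (intro subst_words assms) (auto simp: coords_def)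
  ultimately show thesis
    by (intro that[of "reduce (subst coords w)"]) auto
qed

lemma mirror_prefix_gen1:
  assumes w: "w \<in> words n" "reduce w \<noteq> []" "\<not> prefix (gen 1) (reduce w)"
  shows "prefix (gen 1) (reduce (subst mirror_img w))"
proof -
  obtain y where y: "reduced y" "y \<in> words n" "subst gen_prod y \<approx> w"
    by (rule gen_prod_coordinates[OF w(1)])
  have positive: "prefix (gen 1) (reduce (subst gen_prod z))"
    if "reduced z" "z \<in> words n" "z \<noteq> []" "\<not> snd (hd z)" for z
    using gen_prod_head_subst[OF that(1,2)]
    by cases (use that(2-4) in \<open>auto simp: prefix_gen_iff gen_prod_ends\<close>)
  have "y \<noteq> []"
    using y(3) w(2) by auto
  moreover from this have "snd (hd y)"
    using positive[of y] y w(3) by auto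
  ultimately have "prefix (gen 1) (reduce (subst gen_prod (map flip y)))"
    using y by (intro positive) (auto simp: hd_map flip_def)
  moreover have "subst mirror_img w \<approx> subst mirror_img (subst gen_prod y)"
    using subst_free_cong[OF y(3)] by simp
  moreover have "subst mirror_img (subst gen_prod y) \<approx> subst (\<lambda>k. finv (gen_prod k)) y"
    unfolding subst_subst by (intro subst_free_cong_img subst_mirror_gen_prod)
  ultimately show ?thesis by (simp add: subst_finv_img)
qed

definition mirror_conjugate :: "(nat \<Rightarrow> word) \<Rightarrow> nat \<Rightarrow> word" where
  "mirror_conjugate g k = subst mirror_img (subst g (mirror_img k))"

lemma braid_tuple_mirror_conjugate:
  assumes "braid_tuple e n g"
  shows "braid_tuple e n (mirror_conjugate g)"
  using braid_tuple_subst[OF braid_tuple_subst[OF braid_tuple_mirror_img assms] braid_tuple_mirror_img]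
  by (simp add: mirror_conjugate_def[abs_def])

lemma mirror_conjugate_prefix:
  assumes n: "1 \<le> n" and tup: "braid_tuple False n g" and start: "\<not> prefix (gen 1) (reduce (g 1))"
  shows "prefix (gen 1) (reduce (mirror_conjugate g 1))"
proof -
  from tup n obtain P c where g_1: "reduce (g 1) = conj_word P (c, False)" and "g 1 \<in> words n"
    unfolding braid_tuple_def by force
  then have "finv (g 1) \<in> words n" "reduce (finv (g 1)) \<noteq> []"
    by (simp_all add: reduce_finv)
  moreover have "\<not> prefix (gen 1) (reduce (finv (g 1)))"
    using start g_1 by (cases P) (auto simp: reduce_finv gen_def)
  ultimately have "prefix (gen 1) (reduce (subst mirror_img (finv (g 1))))"
    by (intro mirror_prefix_gen1)
  then show ?thesis by (simp add: mirror_conjugate_def mirror_img_def)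
qed

lemma braid_img_of_mirror_conjugate:
  assumes ws: "ws \<in> words m" and k: "k \<in> {1..n}"
    and g: "\<And>k. k \<in> {1..n} \<Longrightarrow> mirror_conjugate g k \<approx> braid_img ws k"
  shows "g k \<approx> braid_img (map flip ws) k"
proof -
  have mirror_k: "mirror_img k \<in> words n"
    using braid_tuple_mirror_img k by (simp add: braid_tuple_def)
  have "g k \<approx> subst g (subst mirror_img (mirror_img k))"
    using subst_free_cong[OF subst_mirror_mirror[of "gen k"], of g] by simp
  also have "\<dots> = reduce (subst mirror_img (subst mirror_img (subst g (subst mirror_img (mirror_img k)))))"
    by (rule subst_mirror_mirror[symmetric])
  also have "\<dots> = reduce (subst mirror_img (subst (mirror_conjugate g) (mirror_img k)))"
    by (simp add: mirror_conjugate_def[abs_def] subst_subst)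
  also have "\<dots> = reduce (subst mirror_img (subst (braid_img ws) (mirror_img k)))"
    using mirror_k by (intro subst_free_cong subst_free_cong_img g) (auto simp: words_def)
  also have "\<dots> = reduce (subst mirror_img (subst mirror_img (braid_img (map flip ws) k)))"
    using subst_braid_img_mirror[OF ws, of "gen k"] by (intro subst_free_cong) simp
  also have "\<dots> = reduce (braid_img (map flip ws) k)"
    by (rule subst_mirror_mirror)
  finally show ?thesis .
qed

lemma braid_tuple_nonpos_or_nonneg:
  assumes n: "1 \<le> n" and tup: "braid_tuple False n g"
  shows "\<exists>ws\<in>nonpos_words n. (\<forall>k\<in>{1..n}. g k \<approx> braid_img ws k)
    \<or> (\<forall>k\<in>{1..n}. g k \<approx> braid_img (map flip ws) k)"
proof (cases "prefix (gen 1) (reduce (g 1))")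
  case True
  with braid_tuple_nonpos[OF tup] show ?thesis by blast
next
  case False
  from braid_tuple_nonpos[OF braid_tuple_mirror_conjugate[OF tup] mirror_conjugate_prefix[OF n tup False]]
  obtain ws where ws: "ws \<in> nonpos_words n" "\<forall>k\<in>{1..n}. mirror_conjugate g k \<approx> braid_img ws k"
    by blast
  then have "\<forall>k\<in>{1..n}. g k \<approx> braid_img (map flip ws) k"
    using braid_img_of_mirror_conjugate[of ws "n - 1"] by (auto simp: nonpos_words_def)
  with ws(1) show ?thesis by blast
qed

section \<open>The trichotomy\<close>

lemma is_aut_Nil:
  assumes "is_aut n f"
  shows "f [] = []"
proof -
  have "[] \<in> F n" by (simp add: F_iff)
  with assms have "f [] \<in> F n" "f (fmul [] []) = fmul (f []) (f [])"
    by (auto simp: is_aut_def bij_betw_def)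
  then have "f [] @ f [] \<approx> f [] @ []"
    by (simp add: fmul_def F_iff)
  then have "f [] \<approx> []"
    by (simp only: append_free_eq_left_cancel)
  with \<open>f [] \<in> F n\<close> show ?thesis by (simp add: F_iff)
qed

lemma is_aut_finv:
  assumes f: "is_aut n f" and u: "u \<in> F n"
  shows "f (finv u) = finv (f u)"
proof -
  have "finv u \<in> F n" using u by (simp add: F_iff)
  with u f have F: "f u \<in> F n" "f (finv u) \<in> F n"
    and "f (fmul u (finv u)) = fmul (f u) (f (finv u))"
    by (auto simp: is_aut_def bij_betw_def)
  then have "f u @ f (finv u) \<approx> f u @ finv (f u)"
    using is_aut_Nil[OF f] by (simp add: free_group_simps) (simp add: fmul_def)
  then have "f (finv u) \<approx> finv (f u)"
    by (simp only: append_free_eq_left_cancel)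
  with F show ?thesis by (simp add: F_iff)
qed

lemma is_aut_eq_subst:
  assumes f: "is_aut n f" and w: "w \<in> F n"
  shows "f w = reduce (subst (\<lambda>i. f (gen i)) w)"
  using w
proof (induction w)
  case Nil
  then show ?case by (simp add: is_aut_Nil[OF f])
next
  case (Cons a w)
  let ?g = "\<lambda>i. f (gen i)"
  from Cons.prems have F: "[a] \<in> F n" "w \<in> F n" "gen (fst a) \<in> F n" and aw: "reduced (a # w)"
    by (auto simp: F_iff reduced_Cons)
  have "[a] = signed (snd a) (gen (fst a))"
    by (cases a) (auto simp: signed_def gen_def)
  then have "f [a] = subst ?g [a]"
    using is_aut_finv[OF f F(3)] by (simp add: signed_def)
  moreover have "f (fmul [a] w) = fmul (f [a]) (f w)"
    using f F(1,2) by (simp add: is_aut_def)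
  moreover have "fmul [a] w = a # w"
    using aw by (simp add: fmul_def)
  ultimately show ?case
    using Cons.IH[OF F(2)] by (simp add: fmul_def)
qed

lemma B_braid_tuple:
  assumes "\<phi> \<in> B n"
  shows "\<phi> = ext_hom n (\<lambda>i. \<phi> (gen i))" "braid_tuple False n (\<lambda>i. \<phi> (gen i))"
proof -
  let ?g = "\<lambda>i. \<phi> (gen i)"
  from assms have aut: "is_aut n \<phi>" and z1: "\<phi> (z1 n) = z1 n"
    and classes: "(\<lambda>C. \<phi> ` C) ` ((\<lambda>i. conj_class n (gen i)) ` {1..n}) = (\<lambda>i. conj_class n (gen i)) ` {1..n}"
    by (auto simp: B_def bij_betw_def)
  show "\<phi> = ext_hom n ?g"
    using aut is_aut_eq_subst[OF aut]
    by (intro extensionalityI[where A = "F n"]) (auto simp: is_aut_def ext_hom_apply)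
  have "z1 n \<in> F n"
    by (simp add: z1_gen_prod F_iff)
  from is_aut_eq_subst[OF aut this] z1 have "finv (reduce (subst ?g (gen_prod n))) = finv (gen_prod n)"
    by (simp add: z1_gen_prod reduce_finv)
  then have product: "reduce (subst ?g (gen_prod n)) = gen_prod n"
    by (metis finv_finv)
  have "?g i \<in> words n \<and> (\<exists>P c. reduce (?g i) = conj_word P (c, False))" if i: "i \<in> {1..n}" for i
  proof -
    have "gen i \<in> conj_class n (gen i)"
      using i by (auto simp: conj_class_def conjugate_def F_iff fmul_def intro!: bexI[of _ "[]"])
    moreover obtain m where "\<phi> ` conj_class n (gen i) = conj_class n (gen m)"
      using classes i by (metis (no_types, lifting) imageE imageI)
    ultimately have "?g i \<in> conj_class n (gen m)" by blast
    then obtain h where "?g i \<in> F n" and "?g i = reduce (conj_word (finv h) (m, False))"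
      by (auto simp: conj_class_def conjugate_def fmul_def gen_def)
    then show ?thesis
      using conj_word_normal_form[of "finv h" "(m, False)"] by (auto simp: F_iff)
  qed
  with product show "braid_tuple False n ?g"
    by (simp add: braid_tuple_def)
qed

lemma B_braid_word:
  assumes "1 \<le> n" "\<phi> \<in> B n"
  shows "\<exists>ws\<in>nonpos_words n. \<phi> = aut_prod n ws \<or> \<phi> = aut_prod n (map flip ws)"
proof -
  from braid_tuple_nonpos_or_nonneg[OF assms(1) B_braid_tuple(2)[OF assms(2)]]
  obtain ws where ws: "ws \<in> nonpos_words n"
    and "(\<forall>k\<in>{1..n}. \<phi> (gen k) \<approx> braid_img ws k) \<or> (\<forall>k\<in>{1..n}. \<phi> (gen k) \<approx> braid_img (map flip ws) k)"
    by blast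
  then have "\<phi> = ext_hom n (braid_img ws) \<or> \<phi> = ext_hom n (braid_img (map flip ws))"
    using B_braid_tuple(1)[OF assms(2)] ext_hom_cong[of n "\<lambda>i. \<phi> (gen i)"] by metis
  with ws show ?thesis by (auto simp: aut_prod_ext_hom nonpos_words_def)
qed

lemma sigma1_neutral_iff:
  "sigma1_neutral n \<phi> \<longleftrightarrow> (\<exists>ws\<in>nonpos_words n. (1, True) \<notin> set ws \<and> \<phi> = aut_prod n ws)"
proof -
  have "2 \<le> fst a \<and> fst a \<le> n - 1 \<longleftrightarrow> fst a \<in> {1..n - 1} \<and> a \<noteq> (1, False) \<and> a \<noteq> (1, True)"
    for a :: letter
    by (cases a; cases "snd a") auto
  then have "(\<forall>a\<in>set ws. 2 \<le> fst a \<and> fst a \<le> n - 1) \<longleftrightarrow> ws \<in> nonpos_words n \<and> (1, True) \<notin> set ws" for ws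
    by (auto simp: nonpos_words_def words_def)
  then show ?thesis unfolding sigma1_neutral_def by blast
qed

lemma sigma1_positive_iff:
  "sigma1_positive n \<phi> \<longleftrightarrow> (\<exists>ws\<in>nonpos_words n. (1, True) \<in> set ws \<and> \<phi> = aut_prod n (finv ws))"
proof -
  have letter: "1 \<le> fst a \<and> fst a \<le> n - 1 \<and> (snd a \<longrightarrow> 2 \<le> fst a) \<longleftrightarrow> fst a \<in> {1..n - 1} \<and> a \<noteq> (1, True)"
    for a :: letter
    by (cases a) auto
  have "2 \<le> n \<and> (\<forall>a\<in>set ws. 1 \<le> fst a \<and> fst a \<le> n - 1 \<and> (snd a \<longrightarrow> 2 \<le> fst a)) \<and> (1, False) \<in> set ws
      \<longleftrightarrow> finv ws \<in> nonpos_words n \<and> (1, True) \<in> set (finv ws)" for ws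
  proof -
    have "2 \<le> n" if "ws \<in> words (n - 1)" "(1, False) \<in> set ws"
      using that by (force simp: words_def)
    moreover have "(\<forall>a\<in>set ws. fst a \<in> {1..n - 1} \<and> a \<noteq> (1, True))
        \<longleftrightarrow> ws \<in> words (n - 1) \<and> (1, True) \<notin> set ws"
      by (auto simp: words_def)
    ultimately show ?thesis
      unfolding letter by (auto simp: nonpos_words_def)
  qed
  then have "sigma1_positive n \<phi>
      \<longleftrightarrow> (\<exists>ws. finv ws \<in> nonpos_words n \<and> (1, True) \<in> set (finv ws) \<and> \<phi> = aut_prod n ws)"
    unfolding sigma1_positive_def by blast
  also have "\<dots> \<longleftrightarrow> (\<exists>ws\<in>nonpos_words n. (1, True) \<in> set ws \<and> \<phi> = aut_prod n (finv ws))"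
    unfolding Bex_def using finv_finv by metis
  finally show ?thesis .
qed

lemma sigma1_negative_iff:
  assumes "is_aut n \<phi>"
  shows "sigma1_negative n \<phi> \<longleftrightarrow> (\<exists>ws\<in>nonpos_words n. (1, True) \<in> set ws \<and> \<phi> = aut_prod n ws)"
proof -
  have "inv_aut n \<phi> = aut_prod n (finv ws) \<longleftrightarrow> \<phi> = aut_prod n ws" if "ws \<in> nonpos_words n" for ws
  proof
    have words: "ws \<in> words (n - 1)" "finv ws \<in> words (n - 1)"
      using that by (simp_all add: nonpos_words_def)
    show "\<phi> = aut_prod n ws" if "inv_aut n \<phi> = aut_prod n (finv ws)"
      using arg_cong[OF that, of "inv_aut n"] inv_aut_inv_aut[OF assms] inv_aut_prod[OF words(2)]
      by (simp only: finv_finv)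
    show "inv_aut n \<phi> = aut_prod n (finv ws)" if "\<phi> = aut_prod n ws"
      unfolding that by (rule inv_aut_prod[OF words(1)])
  qed
  then show ?thesis unfolding sigma1_negative_def sigma1_positive_iff by blast
qed

lemma B_trichotomy:
  assumes "1 \<le> n" "\<phi> \<in> B n"
  shows "sigma1_neutral n \<phi> \<or> sigma1_negative n \<phi> \<or> sigma1_positive n \<phi>"
proof -
  obtain ws where ws: "ws \<in> nonpos_words n" and "\<phi> = aut_prod n ws \<or> \<phi> = aut_prod n (map flip ws)"
    using B_braid_word[OF assms] by blast
  then consider (nonpos) "\<phi> = aut_prod n ws"
    | (positive) "\<phi> = aut_prod n (map flip ws)" "(1, True) \<in> set ws"
    | (neutral) "\<phi> = aut_prod n (map flip ws)" "(1, True) \<notin> set ws"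
    by blast
  then show ?thesis
  proof cases
    case nonpos
    have "is_aut n \<phi>" using assms(2) by (simp add: B_def)
    with nonpos ws show ?thesis
      unfolding sigma1_neutral_iff by (simp only: sigma1_negative_iff) blast
  next
    case positive
    have "rev ws \<in> nonpos_words n" "(1, True) \<in> set (rev ws)" "\<phi> = aut_prod n (finv (rev ws))"
      using ws positive by (simp_all add: nonpos_words_def words_def finv_def rev_map)
    then show ?thesis unfolding sigma1_positive_iff by blast
  next
    case neutral
    then have "\<forall>a\<in>set (map flip ws). 2 \<le> fst a \<and> fst a \<le> n - 1"
      using nonpos_words_neutral[OF ws] ws by (auto simp: nonpos_words_def words_def)
    with neutral show ?thesis unfolding sigma1_neutral_def by blast
  qed
qed

lemma aut_prod_star_subset:
  assumes "ws \<in> nonpos_words n"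
  shows "aut_prod n ws ` star n (gen 1) \<subseteq> star n (gen 1)"
proof
  fix v assume "v \<in> aut_prod n ws ` star n (gen 1)"
  then obtain w where w: "w \<in> F n" "prefix (gen 1) w" "v = aut_prod n ws w"
    by (auto simp: star_def)
  then show "v \<in> star n (gen 1)"
    using assms nonpos_braid_prefix[OF assms, of w] aut_prod_in_F[of ws n w]
    by (simp add: star_def nonpos_words_def aut_prod_ext_hom ext_hom_apply F_iff)
qed

lemma gen1_notin_negative_image:
  assumes "ws \<in> nonpos_words n" "(1, True) \<in> set ws"
  shows "gen 1 \<notin> aut_prod n ws ` star n (gen 1)"
proof
  assume "gen 1 \<in> aut_prod n ws ` star n (gen 1)"
  then obtain w where "w \<in> F n" "prefix (gen 1) w" "gen 1 = aut_prod n ws w"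
    by (auto simp: star_def)
  then show False
    using assms negative_braid_not_gen1[OF assms, of w]
    by (simp add: nonpos_words_def aut_prod_ext_hom ext_hom_apply F_iff)
qed

lemma gen1_in_star: "1 \<le> n \<Longrightarrow> gen 1 \<in> star n (gen 1)"
  by (simp add: star_def F_iff)

lemma subset_image_if_right_inverse:
  assumes "g ` A \<subseteq> A" "\<And>x. x \<in> A \<Longrightarrow> f (g x) = x"
  shows "A \<subseteq> f ` A"
proof
  fix x assume "x \<in> A"
  with assms(1) have "f (g x) \<in> f ` A" by blast
  with assms(2)[OF \<open>x \<in> A\<close>] show "x \<in> f ` A" by simp
qed

lemma sigma1_neutral_fixes_star:
  assumes n: "1 \<le> n" and "sigma1_neutral n \<phi>"
  shows "\<phi> (gen 1) = gen 1" "\<phi> ` star n (gen 1) = star n (gen 1)"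
proof -
  obtain ws where ws: "ws \<in> nonpos_words n" "(1, True) \<notin> set ws" and \<phi>: "\<phi> = aut_prod n ws"
    using assms(2) unfolding sigma1_neutral_iff by blast
  then have words: "ws \<in> words (n - 1)" by (simp add: nonpos_words_def)
  show "\<phi> (gen 1) = gen 1"
    using n words neutral_braid_img_1[OF nonpos_words_neutral[OF ws]]
    by (simp add: \<phi> aut_prod_ext_hom ext_hom_apply F_iff)
  have "finv ws \<in> nonpos_words n"
    using ws by (simp add: nonpos_words_def)
  then have "aut_prod n (finv ws) ` star n (gen 1) \<subseteq> star n (gen 1)"
    by (rule aut_prod_star_subset)
  moreover have "aut_prod n ws (aut_prod n (finv ws) w) = w" if "w \<in> star n (gen 1)" for w
    using aut_prod_finv[of "finv ws" n w] words that by (simp add: star_def)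
  ultimately have "star n (gen 1) \<subseteq> \<phi> ` star n (gen 1)"
    unfolding \<phi> by (intro subset_image_if_right_inverse)
  with aut_prod_star_subset[OF ws(1)] \<phi> show "\<phi> ` star n (gen 1) = star n (gen 1)"
    by blast
qed

lemma sigma1_negative_shrinks_star:
  assumes n: "1 \<le> n" and "\<phi> \<in> B n" "sigma1_negative n \<phi>"
  shows "\<phi> (gen 1) \<in> star n (gen 1) - {gen 1}" "\<phi> ` star n (gen 1) \<subset> star n (gen 1)"
proof -
  have "is_aut n \<phi>" using assms(2) by (simp add: B_def)
  with assms(3) obtain ws where ws: "ws \<in> nonpos_words n" "(1, True) \<in> set ws" and \<phi>: "\<phi> = aut_prod n ws"
    using sigma1_negative_iff by blast
  have image: "\<phi> ` star n (gen 1) \<subseteq> star n (gen 1)" "gen 1 \<notin> \<phi> ` star n (gen 1)"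
    unfolding \<phi> by (rule aut_prod_star_subset[OF ws(1)], rule gen1_notin_negative_image[OF ws])
  show "\<phi> (gen 1) \<in> star n (gen 1) - {gen 1}"
    using image imageI[OF gen1_in_star[OF n], of \<phi>] by auto
  show "\<phi> ` star n (gen 1) \<subset> star n (gen 1)"
    using image gen1_in_star[OF n] by blast
qed

lemma sigma1_positive_expands_star:
  assumes n: "1 \<le> n" and "sigma1_positive n \<phi>"
  shows "\<phi> (gen 1) \<notin> star n (gen 1)" "\<phi> ` star n (gen 1) \<supset> star n (gen 1)"
proof -
  obtain ws where ws: "ws \<in> nonpos_words n" "(1, True) \<in> set ws" and \<phi>: "\<phi> = aut_prod n (finv ws)"
    using assms(2) unfolding sigma1_positive_iff by blast
  let ?\<psi> = "aut_prod n ws"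
  have inverse: "\<phi> (?\<psi> w) = w" "?\<psi> (\<phi> w) = w" if "w \<in> star n (gen 1)" for w
    using aut_prod_finv[of ws n w] aut_prod_finv[of "finv ws" n w] ws(1) that
    by (auto simp: \<phi> nonpos_words_def star_def)
  show not_star: "\<phi> (gen 1) \<notin> star n (gen 1)"
    using gen1_notin_negative_image[OF ws] inverse(2)[OF gen1_in_star[OF n]]
      imageI[of "\<phi> (gen 1)" "star n (gen 1)" ?\<psi>]
    by auto
  have "star n (gen 1) \<subseteq> \<phi> ` star n (gen 1)"
    using aut_prod_star_subset[OF ws(1)] inverse(1) by (intro subset_image_if_right_inverse)
  with not_star gen1_in_star[OF n] show "\<phi> ` star n (gen 1) \<supset> star n (gen 1)" by blast
qed

theorem theorem6p6:
  fixes n :: nat and \<phi> :: "word \<Rightarrow> word"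
  assumes "1 \<le> n" and "\<phi> \<in> B n"
  defines "a1 \<equiv> \<phi> (gen 1) = gen 1"
    and "a2 \<equiv> \<phi> (gen 1) \<in> star n (gen 1) - {gen 1}"
    and "a3 \<equiv> \<phi> (gen 1) \<notin> star n (gen 1)"
    and "b1 \<equiv> sigma1_neutral n \<phi>"
    and "b2 \<equiv> sigma1_negative n \<phi>"
    and "b3 \<equiv> sigma1_positive n \<phi>"
    and "c1 \<equiv> \<phi> ` star n (gen 1) = star n (gen 1)"
    and "c2 \<equiv> \<phi> ` star n (gen 1) \<subset> star n (gen 1)"
    and "c3 \<equiv> \<phi> ` star n (gen 1) \<supset> star n (gen 1)"
  shows "(a1 \<longleftrightarrow> b1) \<and> (b1 \<longleftrightarrow> c1)
       \<and> (a2 \<longleftrightarrow> b2) \<and> (b2 \<longleftrightarrow> c2)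
       \<and> (a3 \<longleftrightarrow> b3) \<and> (b3 \<longleftrightarrow> c3)
       \<and> ((b1 \<and> \<not> b2 \<and> \<not> b3) \<or> (\<not> b1 \<and> b2 \<and> \<not> b3) \<or> (\<not> b1 \<and> \<not> b2 \<and> b3))"
proof -
  have trichotomy: "b1 \<or> b2 \<or> b3"
    unfolding b1_def b2_def b3_def by (rule B_trichotomy[OF assms(1,2)])
  have neutral: "a1 \<and> c1" if b1
    using sigma1_neutral_fixes_star[OF assms(1)] that unfolding a1_def b1_def c1_def by simp
  have negative: "a2 \<and> c2" if b2
    using sigma1_negative_shrinks_star[OF assms(1,2)] that unfolding a2_def b2_def c2_def by simp
  have positive: "a3 \<and> c3" if b3
    using sigma1_positive_expands_star[OF assms(1)] that unfolding a3_def b3_def c3_def by simp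
  have a_exclusive: "\<not> (a1 \<and> a2)" "\<not> (a1 \<and> a3)" "\<not> (a2 \<and> a3)"
    using gen1_in_star[OF assms(1)] unfolding a1_def a2_def a3_def by auto
  have c_exclusive: "\<not> (c1 \<and> c2)" "\<not> (c1 \<and> c3)" "\<not> (c2 \<and> c3)"
    unfolding c1_def c2_def c3_def by auto
  from trichotomy neutral negative positive a_exclusive c_exclusive show ?thesis by blast
qed

end
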